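(* Let $\phi\in C^1([0,\infty))$ be a non-trivial, non-negative communication kernel. Then any global classical solution $(\rho,v)$ of the Euler alignment system on the circle $\mathbb{T}$ aligns: there is a constant $C$ such that for all sufficiently large $t$ $$\sup_{x\in\mathbb{T}}|v(x,t)-\bar v|\le C\left(\frac{\ln t}{t}\right)^{\frac15},$$ where $$\bar v=\frac1M\int_{\mathbb{T}}v\rho\,dx,\qquad M=\int_{\mathbb{T}}\rho(x,t)\,dx .$$
   Context: $\mathbb{T}=\mathbb{R}/2\pi\mathbb{Z}$, and $|x-y|\in[0,\pi]$ denotes the distance on $\mathbb{T}$. Non-trivial means that $\phi$ is not identically zero on the range $(0,\pi)$ of distances. Euler alignment system on $\mathbb{T}$, for density $\rho(x,t)\ge0$ and velocity $v(x,t)\in\mathbb{R}$: $$\partial_t\rho+\partial_x(v\rho)=0,\qquad \partial_t v+v\,\partial_x v=\int_{\mathbb{T}}\phi(|x-y|)\,(v(y,t)-v(x,t))\,\rho(y,t)\,dy .$$ A global classical solution is a pair of $C^1$ functions $\rho\ge0$ and $v$ on $\mathbb{T}\times[0,\infty)$ satisfying both equations pointwise on all of $\mathbb{T}$, with total mass $M>0$; vacuum ($\rho=0$ on some set) is allowed. The total mass $M$ and the momentum $\int_{\mathbb{T}}v\rho\,dx$ are conserved in time, so $\bar v$ is a constant. *)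

theory Defs
  imports "HOL-Analysis.Analysis"
begin

text \<open>
  Functions on the circle of length \<open>2 * pi\<close> are represented by \<open>2 * pi\<close>-periodic functions on the
  reals, so that spatial derivatives are ordinary ones and the integral over the circle is the
  integral over one period.  A function of space and time is written \<open>u x t\<close>; only its values at
  times \<open>t \<ge> 0\<close> are meaningful.
\<close>

text \<open>
  Continuous differentiability up to the boundary of \<open>S\<close>.  This is used only for sets \<open>S\<close> (a closed
  half-line, a closed half-plane) on which the derivative within \<open>S\<close> is unique.
\<close>

definition C1_on :: "'a::real_normed_vector set \<Rightarrow> ('a \<Rightarrow> 'b::real_normed_vector) \<Rightarrow> bool" where
  "C1_on S f \<longleftrightarrow>
     (\<exists>f' :: 'a \<Rightarrow> 'a \<Rightarrow>\<^sub>L 'b. continuous_on S f' \<and>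
        (\<forall>z\<in>S. (f has_derivative blinfun_apply (f' z)) (at z within S)))"

definition circle_periodic :: "(real \<Rightarrow> 'a) \<Rightarrow> bool" where
  "circle_periodic f \<longleftrightarrow> (\<forall>x. f (x + 2 * pi) = f x)"

definition circle_dist :: "real \<Rightarrow> real \<Rightarrow> real" where
  "circle_dist x y = (INF k::int. \<bar>x - y + 2 * pi * of_int k\<bar>)"

definition circle_integral :: "(real \<Rightarrow> real) \<Rightarrow> real" where
  "circle_integral f = integral {0..2 * pi} f"

definition partial_x :: "(real \<Rightarrow> real \<Rightarrow> real) \<Rightarrow> real \<Rightarrow> real \<Rightarrow> real" where
  "partial_x u x t = deriv (\<lambda>y. u y t) x"

text \<open>The time derivative is one-sided at \<open>t = 0\<close>, whence \<^const>\<open>vector_derivative\<close> within \<open>{0..}\<close>.\<close>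

definition partial_t :: "(real \<Rightarrow> real \<Rightarrow> real) \<Rightarrow> real \<Rightarrow> real \<Rightarrow> real" where
  "partial_t u x t = vector_derivative (\<lambda>s. u x s) (at t within {0..})"

definition total_mass :: "(real \<Rightarrow> real \<Rightarrow> real) \<Rightarrow> real \<Rightarrow> real" where
  "total_mass \<rho> t = circle_integral (\<lambda>x. \<rho> x t)"

definition mean_velocity :: "(real \<Rightarrow> real \<Rightarrow> real) \<Rightarrow> (real \<Rightarrow> real \<Rightarrow> real) \<Rightarrow> real \<Rightarrow> real" where
  "mean_velocity \<rho> v t = circle_integral (\<lambda>x. v x t * \<rho> x t) / total_mass \<rho> t"

text \<open>
  The mass is conserved by the first equation, so positivity is only required at \<open>t = 0\<close>.
\<close>

definition global_classical_solution ::
    "(real \<Rightarrow> real) \<Rightarrow> (real \<Rightarrow> real \<Rightarrow> real) \<Rightarrow> (real \<Rightarrow> real \<Rightarrow> real) \<Rightarrow> bool" where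
  "global_classical_solution \<phi> \<rho> v \<longleftrightarrow>
     (\<forall>t\<ge>0. circle_periodic (\<lambda>x. \<rho> x t) \<and> circle_periodic (\<lambda>x. v x t)) \<and>
     C1_on (UNIV \<times> {0..}) (\<lambda>(x, t). \<rho> x t) \<and>
     C1_on (UNIV \<times> {0..}) (\<lambda>(x, t). v x t) \<and>
     (\<forall>x. \<forall>t\<ge>0. \<rho> x t \<ge> 0) \<and>
     total_mass \<rho> 0 > 0 \<and>
     (\<forall>x. \<forall>t\<ge>0. partial_t \<rho> x t + partial_x (\<lambda>y s. v y s * \<rho> y s) x t = 0) \<and>
     (\<forall>x. \<forall>t\<ge>0. partial_t v x t + v x t * partial_x v x t =
        circle_integral (\<lambda>y. \<phi> (circle_dist x y) * (v y t - v x t) * \<rho> y t))"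

end

theory Submission
  imports Defs
begin

text \<open>
  Write \<open>u = v - vbar\<close>, \<open>\<theta> = k * \<rho>\<close> and \<open>r = k * (\<rho> u)\<close>, where \<open>*\<close> is convolution over the circle and
  \<open>k\<close> is the kernel as an even periodic function of the difference of positions.  Along the flow
  \<open>D = \<partial>\<^sub>t + v \<partial>\<^sub>x\<close> the velocity satisfies \<open>D u = r - u \<theta>\<close>.  The damping \<open>\<theta>\<close> may vanish, so neither
  the energy nor the maximum of \<open>\<bar>u\<bar>\<close> need decrease at a definite rate at a given time.  But two
  particles with different velocities keep meeting on the circle, hence they pass again and again
  through the range of positive interaction.

  This is made quantitative by a corrector.  Choose \<open>\<kappa>\<close> such that \<open>1 - \<kappa> k\<close> has mean zero, let
  \<open>\<eta>\<close> be a periodic primitive of \<open>1 - \<kappa> k\<close>, and let \<open>\<Psi> = \<eta> * \<rho>\<close>.  This function is bounded, and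
  the continuity equation gives \<open>D \<Psi> = mass u - \<kappa> (u \<theta> - r)\<close>
  (\<open>Psi_material_derivative\<close>): a coercive term, up to a multiple of the alignment force.
  Everything is done with the fields themselves, without characteristics; pointwise bounds come from
  comparison with a barrier at the first time of contact (\<open>C1_field_below_barrier\<close>).

  \<^item> As \<open>D (\<kappa> u - \<Psi>) = - mass u\<close>, the velocity is bounded uniformly in time (\<open>u_bounded\<close>).

  \<^item> The energy \<open>E = \<integral> \<rho> u\<^sup>2\<close> has derivative \<open>- Diss\<close>.  With \<open>G = \<integral> \<rho> u \<Psi>\<close> the derivative of
    \<open>E - \<epsilon> E G\<close> is at most \<open>- c E\<^sup>2\<close>, because every error term in \<open>(E G)'\<close> is bounded by a
    multiple of the dissipation plus half of the coercive term \<open>mass E\<^sup>2\<close>.  Hence \<open>E = O(1 / t)\<close>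
    (\<open>energy_decay\<close>), and so \<open>r = O(t\<^sup>-\<^sup>1\<^sup>/\<^sup>2)\<close> uniformly in space.

  \<^item> For small \<open>\<lambda>\<close> the function \<open>Z = u exp (- \<lambda> \<Psi>)\<close> satisfies \<open>D Z \<le> C \<bar>r\<bar> - c Z\<^sup>2\<close> where \<open>u > 0\<close>, and
    similarly for \<open>- u\<close>.  Hence \<open>sup \<bar>u\<bar> = O(t\<^sup>-\<^sup>1\<^sup>/\<^sup>4)\<close> (\<open>velocity_decay\<close>).

  The last rate is better than \<open>(ln t / t)\<^sup>1\<^sup>/\<^sup>5\<close>.
\<close>

section \<open>Integrals over the circle\<close>

lemma circle_integrable:
  "continuous_on UNIV f \<Longrightarrow> f integrable_on {0..2 * pi :: real}" for f :: "real \<Rightarrow> real"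
  by (rule integrable_continuous_interval) (erule continuous_on_subset, simp)

lemma circle_integral_add:
  assumes "continuous_on UNIV f" "continuous_on UNIV g"
  shows "circle_integral (\<lambda>x. f x + g x) = circle_integral f + circle_integral g"
  unfolding circle_integral_def using assms by (intro integral_add circle_integrable)

lemma circle_integral_diff:
  assumes "continuous_on UNIV f" "continuous_on UNIV g"
  shows "circle_integral (\<lambda>x. f x - g x) = circle_integral f - circle_integral g"
  unfolding circle_integral_def using assms by (intro integral_diff circle_integrable)

lemma circle_integral_cmult: "circle_integral (\<lambda>x. c * f x) = c * circle_integral f"
  unfolding circle_integral_def by simp

lemma circle_integral_cmult_right: "circle_integral (\<lambda>x. f x * c) = circle_integral f * c"
  unfolding circle_integral_def by simp

lemma circle_integral_uminus: "circle_integral (\<lambda>x. - f x) = - circle_integral f"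
  unfolding circle_integral_def by simp

lemma circle_integral_const: "circle_integral (\<lambda>x. c) = 2 * pi * c"
  unfolding circle_integral_def by simp

lemma circle_integral_mono:
  assumes "continuous_on UNIV f" "continuous_on UNIV g" "\<And>x. f x \<le> g x"
  shows "circle_integral f \<le> circle_integral g"
  unfolding circle_integral_def using assms by (intro integral_le circle_integrable) auto

lemma circle_integral_nonneg:
  assumes "continuous_on UNIV f" "\<And>x. 0 \<le> f x"
  shows "0 \<le> circle_integral f"
  unfolding circle_integral_def using assms by (intro integral_nonneg circle_integrable) auto

lemma abs_circle_integral_le:
  assumes "continuous_on UNIV f" "continuous_on UNIV g" "\<And>x. \<bar>f x\<bar> \<le> g x"
  shows "\<bar>circle_integral f\<bar> \<le> circle_integral g"
proof -
  have "circle_integral f \<le> circle_integral g"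
    using assms by (intro circle_integral_mono) (auto simp: abs_le_iff)
  moreover have "circle_integral (\<lambda>x. - f x) \<le> circle_integral g"
    using assms by (intro circle_integral_mono continuous_intros) (auto simp: abs_le_iff)
  ultimately show ?thesis by (simp add: circle_integral_uminus)
qed

lemma circle_integral_pos:
  assumes "continuous_on UNIV f" "\<And>x. 0 \<le> f x" "c \<in> {0..2 * pi}" "f c \<noteq> 0"
  shows "0 < circle_integral f"
proof -
  have "circle_integral f \<noteq> 0"
  proof
    assume "circle_integral f = 0"
    then have "integral (cbox 0 (2 * pi)) f = 0"
      by (simp add: circle_integral_def cbox_interval)
    moreover have "f integrable_on cbox 0 (2 * pi)"
      using circle_integrable[OF assms(1)] by (simp add: cbox_interval)
    ultimately have "(f has_integral 0) (cbox 0 (2 * pi))"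
      by (metis integrable_integral)
    then have "f c = 0"
      using assms pi_gt_zero
      by (intro has_integral_0_cbox_imp_0[of 0 "2 * pi" f])
        (auto simp: box_real cbox_interval simp del: pi_gt_zero intro: continuous_on_subset)
    with assms show False by simp
  qed
  with circle_integral_nonneg[OF assms(1,2)] show ?thesis by simp
qed

lemma circle_integral_deriv_periodic:
  assumes "\<And>x. (f has_real_derivative f' x) (at x)" "f (2 * pi) = f 0"
  shows "circle_integral f' = 0"
proof -
  have "(f' has_integral f (2 * pi) - f 0) {0..2 * pi}"
    using assms(1)
    by (intro fundamental_theorem_of_calculus)
      (auto simp flip: has_real_derivative_iff_has_vector_derivative
        intro: has_field_derivative_at_within)
  then show ?thesis
    using assms(2) by (simp add: circle_integral_def integral_unique)
qed

lemma circle_integral_swap: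
  fixes f :: "real \<Rightarrow> real \<Rightarrow> real"
  assumes "continuous_on UNIV (\<lambda>z. f (fst z) (snd z))"
  shows "circle_integral (\<lambda>x. circle_integral (\<lambda>y. f x y)) =
         circle_integral (\<lambda>y. circle_integral (\<lambda>x. f x y))"
proof -
  have "continuous_on (cbox (0, 0) (2 * pi, 2 * pi)) (\<lambda>(x, y). f x y)"
    using assms by (auto simp: split_beta intro: continuous_on_subset)
  from integral_swap_continuous[OF this] show ?thesis
    by (simp add: circle_integral_def cbox_interval)
qed

lemma periodic_representative:
  fixes f :: "real \<Rightarrow> 'a"
  assumes "\<And>x. f (x + 2 * pi) = f x"
  obtains y where "y \<in> {0..2 * pi}" "f y = f x"
proof -
  interpret periodic_fun_simple f "2 * pi"
    using assms by unfold_locales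
  define n where "n = \<lfloor>x / (2 * pi)\<rfloor>"
  have "of_int n \<le> x / (2 * pi)" "x / (2 * pi) < of_int n + 1"
    unfolding n_def by linarith+
  then have "x - of_int n * (2 * pi) \<in> {0..2 * pi}"
    by (auto simp: field_simps)
  then show ?thesis using minus_of_int[of x n] that by blast
qed

lemma periodic_bounded:
  fixes f :: "real \<Rightarrow> real"
  assumes "continuous_on UNIV f" "\<And>x. f (x + 2 * pi) = f x"
  obtains K where "K > 0" "\<And>x. \<bar>f x\<bar> \<le> K"
proof -
  have "compact (f ` {0..2 * pi})"
    using assms(1) by (intro compact_continuous_image) (auto intro: continuous_on_subset)
  then obtain K where K: "K > 0" "\<And>x. x \<in> {0..2 * pi} \<Longrightarrow> norm (f x) \<le> K"
    using compact_imp_bounded bounded_pos by (metis image_eqI)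
  have "\<bar>f x\<bar> \<le> K" for x
    using periodic_representative[of f x] assms(2) K(2) by (metis real_norm_def)
  with K that show ?thesis by blast
qed

section \<open>Fields on space-time\<close>

text \<open>Joint continuity of a field on \<open>\<real> \<times> [0, \<infinity>)\<close>.\<close>

definition spacetime_continuous :: "(real \<Rightarrow> real \<Rightarrow> real) \<Rightarrow> bool" where
  "spacetime_continuous g \<longleftrightarrow> continuous_on (UNIV \<times> {0..}) (\<lambda>z. g (fst z) (snd z))"

text \<open>
  A periodic field of class \<open>C\<^sup>1\<close> together with its two partial derivatives, the time derivative
  being one-sided at time \<open>0\<close>.
\<close>

definition C1_field ::
    "(real \<Rightarrow> real \<Rightarrow> real) \<Rightarrow> (real \<Rightarrow> real \<Rightarrow> real) \<Rightarrow> (real \<Rightarrow> real \<Rightarrow> real) \<Rightarrow> bool" where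
  "C1_field g gx gt \<longleftrightarrow>
     (\<forall>t\<ge>0. \<forall>x. g (x + 2 * pi) t = g x t) \<and>
     (\<forall>t\<ge>0. \<forall>x. ((\<lambda>y. g y t) has_real_derivative gx x t) (at x)) \<and>
     (\<forall>t\<ge>0. \<forall>x. ((\<lambda>s. g x s) has_real_derivative gt x t) (at t within {0..})) \<and>
     spacetime_continuous g \<and> spacetime_continuous gx \<and> spacetime_continuous gt"

lemma C1_fieldD:
  assumes "C1_field g gx gt"
  shows "t \<ge> 0 \<Longrightarrow> g (x + 2 * pi) t = g x t"
    and "t \<ge> 0 \<Longrightarrow> ((\<lambda>y. g y t) has_real_derivative gx x t) (at x)"
    and "t \<ge> 0 \<Longrightarrow> ((\<lambda>s. g x s) has_real_derivative gt x t) (at t within {0..})"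
    and "spacetime_continuous g" "spacetime_continuous gx" "spacetime_continuous gt"
  using assms by (auto simp: C1_field_def)

lemma spacetime_continuous_slice:
  assumes "spacetime_continuous g" "t \<ge> 0"
  shows "continuous_on UNIV (\<lambda>x. g x t)"
proof -
  have "continuous_on UNIV (\<lambda>x. (x, t))" by (intro continuous_intros)
  from continuous_on_compose2[OF assms(1)[unfolded spacetime_continuous_def] this] assms(2)
  show ?thesis by auto
qed

lemma spacetime_continuous_comp:
  assumes "spacetime_continuous g" "continuous_on S a" "continuous_on S b" "\<And>z. z \<in> S \<Longrightarrow> b z \<ge> 0"
  shows "continuous_on S (\<lambda>z. g (a z) (b z))"
proof -
  have "continuous_on S (\<lambda>z. (a z, b z))" using assms by (intro continuous_intros)
  from continuous_on_compose2[OF assms(1)[unfolded spacetime_continuous_def] this] assms(4)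
  show ?thesis by auto
qed

lemma spacetime_continuous_const: "spacetime_continuous (\<lambda>x t. c)"
  by (simp add: spacetime_continuous_def)

lemma spacetime_continuous_arith:
  assumes "spacetime_continuous f" "spacetime_continuous g"
  shows "spacetime_continuous (\<lambda>x t. f x t + g x t)"
    and "spacetime_continuous (\<lambda>x t. f x t - g x t)"
    and "spacetime_continuous (\<lambda>x t. f x t * g x t)"
  using assms unfolding spacetime_continuous_def by (auto intro!: continuous_intros)

lemma spacetime_continuous_uminus:
  assumes "spacetime_continuous f"
  shows "spacetime_continuous (\<lambda>x t. - f x t)"
  using assms unfolding spacetime_continuous_def by (auto intro!: continuous_intros)

lemma spacetime_continuous_exp:
  assumes "spacetime_continuous f"
  shows "spacetime_continuous (\<lambda>x t. exp (f x t))"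
  using assms unfolding spacetime_continuous_def by (auto intro!: continuous_intros)

lemmas spacetime_continuous_intros =
  spacetime_continuous_const spacetime_continuous_arith spacetime_continuous_uminus
  spacetime_continuous_exp

lemma C1_field_const: "C1_field (\<lambda>x t. c) (\<lambda>x t. 0) (\<lambda>x t. 0)"
  by (simp add: C1_field_def spacetime_continuous_const)

lemma C1_field_mult:
  assumes "C1_field f fx ft" "C1_field g gx gt"
  shows "C1_field (\<lambda>x t. f x t * g x t) (\<lambda>x t. fx x t * g x t + f x t * gx x t)
           (\<lambda>x t. ft x t * g x t + f x t * gt x t)"
  unfolding C1_field_def
proof (intro conjI allI impI spacetime_continuous_intros)
  fix x t :: real assume t: "0 \<le> t"
  show "((\<lambda>y. f y t * g y t) has_real_derivative fx x t * g x t + f x t * gx x t) (at x)"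
    using DERIV_mult[OF C1_fieldD(2)[OF assms(1) t] C1_fieldD(2)[OF assms(2) t], of x]
    by (simp add: mult.commute)
  show "((\<lambda>s. f x s * g x s) has_real_derivative ft x t * g x t + f x t * gt x t)
      (at t within {0..})"
    using DERIV_mult[OF C1_fieldD(3)[OF assms(1) t] C1_fieldD(3)[OF assms(2) t], of x]
    by (simp add: mult.commute)
qed (use C1_fieldD[OF assms(1)] C1_fieldD[OF assms(2)] in simp_all)

lemma C1_field_diff:
  assumes "C1_field f fx ft" "C1_field g gx gt"
  shows "C1_field (\<lambda>x t. f x t - g x t) (\<lambda>x t. fx x t - gx x t) (\<lambda>x t. ft x t - gt x t)"
  using C1_fieldD[OF assms(1)] C1_fieldD[OF assms(2)] unfolding C1_field_def
  by (auto intro!: spacetime_continuous_intros derivative_eq_intros)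

lemma C1_field_cmult:
  assumes "C1_field f fx ft"
  shows "C1_field (\<lambda>x t. c * f x t) (\<lambda>x t. c * fx x t) (\<lambda>x t. c * ft x t)"
  using C1_field_mult[OF C1_field_const[of c] assms] by simp

lemma C1_field_exp:
  assumes "C1_field f fx ft"
  shows "C1_field (\<lambda>x t. exp (f x t)) (\<lambda>x t. exp (f x t) * fx x t) (\<lambda>x t. exp (f x t) * ft x t)"
  using C1_fieldD[OF assms] unfolding C1_field_def
  by (auto intro!: spacetime_continuous_intros derivative_eq_intros)

lemma field_circle_integral_derivative:
  assumes g: "spacetime_continuous g" and gt: "spacetime_continuous gt"
    and der: "\<And>x t. t \<ge> 0 \<Longrightarrow> ((\<lambda>s. g x s) has_real_derivative gt x t) (at t within {0..})"
    and t: "t \<ge> 0"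
  shows "((\<lambda>s. circle_integral (\<lambda>x. g x s)) has_real_derivative circle_integral (\<lambda>x. gt x t))
           (at t within {0..})"
proof -
  have "((\<lambda>s. integral (cbox 0 (2 * pi)) (\<lambda>x. g x s)) has_real_derivative
          integral (cbox 0 (2 * pi)) (\<lambda>x. gt x t)) (at t within {0..})"
  proof (rule leibniz_rule_field_derivative)
    show "(\<lambda>x. g x s) integrable_on cbox 0 (2 * pi)" if "s \<in> {0..}" for s
      using circle_integrable[OF spacetime_continuous_slice[OF g]] that
      by (simp add: cbox_interval)
    show "continuous_on ({0..} \<times> cbox 0 (2 * pi)) (\<lambda>(s, x). gt x s)"
      unfolding split_beta
      by (rule spacetime_continuous_comp[OF gt]) (auto intro!: continuous_intros)
  qed (use der t in auto)
  then show ?thesis by (simp add: circle_integral_def cbox_interval)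
qed

text \<open>
  Comparison with a barrier.  At the first time at which \<open>Z\<close> touches \<open>B\<close>, the touching point is a
  spatial maximum of \<open>Z\<close>, and \<open>Z\<close> cannot grow slower than \<open>B\<close> there.
\<close>

lemma C1_field_below_barrier:
  assumes Z: "C1_field Z Zx Zt" and t0: "t0 \<ge> 0"
    and B: "\<And>t. t \<ge> t0 \<Longrightarrow> (B has_real_derivative B' t) (at t)"
    and init: "\<And>x. Z x t0 < B t0"
    and touch: "\<And>x t. t > t0 \<Longrightarrow> Z x t = B t \<Longrightarrow> Zx x t = 0 \<Longrightarrow> Zt x t < B' t"
    and t1: "t1 \<ge> t0"
  shows "Z x1 t1 < B t1"
proof (rule ccontr)
  assume "\<not> Z x1 t1 < B t1"
  then have x1: "Z x1 t1 \<ge> B t1" by simp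
  note Z_per = C1_fieldD(1)[OF Z] and Z_x = C1_fieldD(2)[OF Z] and Z_t = C1_fieldD(3)[OF Z]
    and Z_cont = C1_fieldD(4)[OF Z]
  have B_cont: "continuous_on {t0..t1} B"
    using B by (meson DERIV_continuous_on has_field_derivative_at_within atLeastAtMost_iff)
  have red: "\<exists>y\<in>{0..2 * pi}. Z y t = Z x t" if "t \<ge> 0" for x t
    using periodic_representative[of "\<lambda>x. Z x t" x] Z_per[OF that] by metis
  \<comment> \<open>By compactness of one period there is a first contact time \<open>ts\<close>.\<close>
  let ?Q = "{0..2 * pi} \<times> {t0..t1}"
  define S where "S = {z \<in> ?Q. Z (fst z) (snd z) - B (snd z) \<ge> 0}"
  have "continuous_on ?Q (\<lambda>z. Z (fst z) (snd z) - B (snd z))"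
    using t0 B_cont
    by (intro continuous_on_diff spacetime_continuous_comp[OF Z_cont]
        continuous_on_compose2[OF B_cont] continuous_intros) auto
  then have "closed (?Q \<inter> (\<lambda>z. Z (fst z) (snd z) - B (snd z)) -` {0..})"
    by (intro continuous_closed_preimage closed_Times) auto
  also have "?Q \<inter> (\<lambda>z. Z (fst z) (snd z) - B (snd z)) -` {0..} = S"
    by (auto simp: S_def)
  finally have "closed S" .
  then have S_compact: "compact S"
    using compact_Times[OF compact_Icc compact_Icc, of 0 "2 * pi" t0 t1]
    by (metis (no_types, lifting) S_def closed_Int_compact inf.orderE mem_Collect_eq subsetI)
  obtain y1 where "y1 \<in> {0..2 * pi}" "Z y1 t1 = Z x1 t1"
    using red t0 t1 by (meson order_trans)
  with x1 t1 have "(y1, t1) \<in> S" by (auto simp: S_def)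
  then obtain z where z: "z \<in> S" "\<And>w. w \<in> S \<Longrightarrow> snd z \<le> snd w"
    using continuous_attains_inf[OF S_compact _ continuous_on_snd[OF continuous_on_id]] by blast
  define xs ts where "xs = fst z" and "ts = snd z"
  have ts: "t0 \<le> ts" "ts \<le> t1" and ge: "Z xs ts \<ge> B ts"
    using z(1) by (auto simp: S_def xs_def ts_def)
  have below: "Z x t < B t" if t: "t0 \<le> t" "t < ts" for x t
  proof (rule ccontr)
    assume *: "\<not> Z x t < B t"
    obtain y where y: "y \<in> {0..2 * pi}" "Z y t = Z x t"
      using red t t0 by (meson order_trans)
    then have "(y, t) \<in> S" using * t ts by (auto simp: S_def)
    from z(2)[OF this] t show False by (simp add: ts_def)
  qed
  have "ts \<noteq> t0" using init[of xs] ge by auto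
  with ts have "ts > t0" by simp
  then have ts_pos: "ts > 0" using t0 by simp
  have at_ts: "at ts within {0..} = at ts"
    using ts_pos by (intro at_within_interior) auto
  have Zs: "((\<lambda>s. Z x s - B s) has_real_derivative (Zt x ts - B' ts)) (at ts)" for x
    using Z_t[of ts x] B[of ts] ts ts_pos by (intro derivative_intros) (auto simp: at_ts)
  have le: "Z x ts \<le> B ts" for x
  proof (rule ccontr)
    assume "\<not> Z x ts \<le> B ts"
    then have pos: "0 < Z x ts - B ts" by simp
    have "isCont (\<lambda>s. Z x s - B s) ts" using Zs DERIV_isCont by blast
    then have "((\<lambda>s. Z x s - B s) \<longlongrightarrow> Z x ts - B ts) (at_left ts)"
      unfolding isCont_def by (rule filterlim_at_split[THEN iffD1, THEN conjunct1])
    then have "eventually (\<lambda>s. 0 < Z x s - B s) (at_left ts)"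
      using pos order_tendstoD(1) by blast
    moreover have "eventually (\<lambda>s. s \<in> {t0<..<ts}) (at_left ts)"
      using \<open>ts > t0\<close> by (intro eventually_at_leftI) auto
    ultimately have "eventually (\<lambda>s. False) (at_left ts)"
    proof eventually_elim
      case (elim s)
      with below[of s x] show ?case by simp
    qed
    then show False by (simp add: trivial_limit_at_left_real)
  qed
  have eq: "Z xs ts = B ts" using ge le[of xs] by simp
  have "Zx xs ts = 0"
    using Z_x[of ts xs] ts_pos le eq by (intro DERIV_local_max[of _ _ xs 1]) auto
  from touch[OF \<open>ts > t0\<close> eq this] have "Zt xs ts - B' ts < 0" by simp
  from DERIV_neg_dec_left[OF Zs this] obtain d where
    d: "d > 0" "\<And>h. h > 0 \<Longrightarrow> h < d \<Longrightarrow> Z xs ts - B ts < Z xs (ts - h) - B (ts - h)"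
    by blast
  define h where "h = min (d / 2) ((ts - t0) / 2)"
  have "h > 0" "h < d" "h < ts - t0" using d(1) \<open>ts > t0\<close> by (auto simp: h_def min_def)
  with d(2)[of h] below[of "ts - h" xs] eq show False by auto
qed


lemma circle_integral_conv_symmetric:
  assumes h: "continuous_on UNIV h" "\<And>z. h (- z) = h z"
    and a: "continuous_on UNIV a" and b: "continuous_on UNIV b"
  shows "circle_integral (\<lambda>x. a x * circle_integral (\<lambda>y. h (x - y) * b y)) =
         circle_integral (\<lambda>x. b x * circle_integral (\<lambda>y. h (x - y) * a y))"
proof -
  have "circle_integral (\<lambda>x. circle_integral (\<lambda>y. a x * (h (x - y) * b y))) =
        circle_integral (\<lambda>y. circle_integral (\<lambda>x. a x * (h (x - y) * b y)))"
    by (rule circle_integral_swap)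
      (intro continuous_intros continuous_on_compose2[OF h(1)] continuous_on_compose2[OF a]
        continuous_on_compose2[OF b] subset_UNIV)
  also have "\<dots> = circle_integral (\<lambda>y. circle_integral (\<lambda>x. b y * (h (y - x) * a x)))"
    using h(2)[of "x - y" for x y] by (simp add: mult_ac)
  finally show ?thesis by (simp only: circle_integral_cmult)
qed

text \<open>Spatial convolution over the circle, at each time.\<close>

definition circle_conv :: "(real \<Rightarrow> real) \<Rightarrow> (real \<Rightarrow> real \<Rightarrow> real) \<Rightarrow> real \<Rightarrow> real \<Rightarrow> real" where
  "circle_conv h g x t = circle_integral (\<lambda>y. h (x - y) * g y t)"

lemma spacetime_continuous_circle_conv:
  assumes h: "continuous_on UNIV h" and g: "spacetime_continuous g"
  shows "spacetime_continuous (circle_conv h g)"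
proof -
  have "continuous_on ((UNIV \<times> {0..}) \<times> cbox 0 (2 * pi)) (\<lambda>(z, y). h (fst z - y) * g y (snd z))"
    unfolding split_beta
    by (intro continuous_on_mult continuous_on_compose2[OF h] spacetime_continuous_comp[OF g]
        continuous_intros) auto
  from integral_continuous_on_param[OF this] show ?thesis
    by (simp add: spacetime_continuous_def circle_conv_def circle_integral_def cbox_interval)
qed

lemma nonincreasing_if_deriv_nonpos:
  fixes f :: "real \<Rightarrow> real"
  assumes der: "\<And>t. t \<ge> 0 \<Longrightarrow> (f has_real_derivative f' t) (at t within {0..})"
    and "\<And>t. t \<ge> 0 \<Longrightarrow> f' t \<le> 0" and ab: "0 \<le> a" "a \<le> b"
  shows "f b \<le> f a"
proof (rule DERIV_nonpos_imp_decreasing_open[OF ab(2)])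
  fix x assume x: "a < x" "x < b"
  then have "at x within {0..} = at x"
    using ab by (intro at_within_interior) auto
  then show "\<exists>y. (f has_real_derivative y) (at x) \<and> y \<le> 0"
    using der[of x] assms(2)[of x] ab x by auto
next
  have "continuous_on {0..} f"
    using der by (meson DERIV_continuous_on atLeast_iff)
  then show "continuous_on {a..b} f" using ab by (auto intro: continuous_on_subset)
qed

text \<open>
  The reason for the decay is that \<open>1 / f\<close> grows at rate at least \<open>c\<close>.
\<close>

lemma riccati_decay:
  fixes f :: "real \<Rightarrow> real"
  assumes der: "\<And>t. t \<ge> 0 \<Longrightarrow> (f has_real_derivative f' t) (at t within {0..})"
    and le: "\<And>t. t \<ge> 0 \<Longrightarrow> f' t \<le> - c * (f t)\<^sup>2"
    and nonneg: "\<And>t. t \<ge> 0 \<Longrightarrow> 0 \<le> f t" and c: "c > 0" and t: "t > 0"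
  shows "f t \<le> 1 / (c * t)"
proof (cases "f t = 0")
  case True
  with c t show ?thesis by simp
next
  case False
  have pos: "f s > 0" if "0 \<le> s" "s \<le> t" for s
  proof -
    have "f' r \<le> 0" if "r \<ge> 0" for r
      using le[OF that] c by (smt (verit) mult_minus_left mult_nonneg_nonneg zero_le_power2)
    then have "f t \<le> f s"
      using nonincreasing_if_deriv_nonpos[OF der] that by blast
    with False nonneg[of t] t show ?thesis by simp
  qed
  have "1 / f 0 - c * 0 \<le> 1 / f t - c * t"
  proof (rule DERIV_nonneg_imp_increasing_open[of 0 t "\<lambda>s. 1 / f s - c * s"])
    fix s assume s: "0 < s" "s < t"
    then have "at s within {0..} = at s"
      by (intro at_within_interior) auto
    then have "((\<lambda>s. 1 / f s - c * s) has_real_derivative (- f' s / (f s)\<^sup>2 - c)) (at s)"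
      using der[of s] s pos[of s]
      by (auto intro!: derivative_eq_intros simp: power2_eq_square)
    moreover have "- f' s / (f s)\<^sup>2 - c \<ge> 0"
      using le[of s] pos[of s] s by (simp add: field_simps)
    ultimately show "\<exists>y. ((\<lambda>s. 1 / f s - c * s) has_real_derivative y) (at s) \<and> 0 \<le> y" by blast
  next
    have "continuous_on {0..} f"
      using der by (meson DERIV_continuous_on atLeast_iff)
    then have "continuous_on {0..t} f" by (auto intro: continuous_on_subset)
    then show "continuous_on {0..t} (\<lambda>s. 1 / f s - c * s)"
      using pos by (intro continuous_intros) force+
  qed (use t in simp)
  then have "c * t \<le> 1 / f t" using pos[of 0] t by (smt (verit) divide_nonneg_pos mult_zero_right)
  then show ?thesis using pos[of t] t c by (simp add: field_simps)
qed

section \<open>The flow and its conserved quantities\<close>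

text \<open>
  A solution with the interaction kernel written as an even periodic function \<open>k\<close> of the
  difference of the positions, and with the partial derivatives of density and velocity named.
\<close>

locale circle_alignment =
  fixes k :: "real \<Rightarrow> real" and \<rho> \<rho>x \<rho>t v vx vt :: "real \<Rightarrow> real \<Rightarrow> real"
  assumes k_cont: "continuous_on UNIV k"
    and k_per: "k (z + 2 * pi) = k z"
    and k_even: "k (- z) = k z"
    and k_nonneg: "0 \<le> k z"
    and k_int: "0 < circle_integral k"
    and rho_field: "C1_field \<rho> \<rho>x \<rho>t"
    and v_field: "C1_field v vx vt"
    and rho_nonneg: "t \<ge> 0 \<Longrightarrow> 0 \<le> \<rho> x t"
    and mass_pos': "0 < circle_integral (\<lambda>x. \<rho> x 0)"
    and continuity_eq: "t \<ge> 0 \<Longrightarrow> \<rho>t x t + (vx x t * \<rho> x t + v x t * \<rho>x x t) = 0"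
    and momentum_eq: "t \<ge> 0 \<Longrightarrow> vt x t + v x t * vx x t =
          circle_integral (\<lambda>y. k (x - y) * (v y t - v x t) * \<rho> y t)"
begin

text \<open>Mass and mean velocity at time \<open>0\<close>; both turn out to be conserved.\<close>

definition mass :: real where
  "mass = circle_integral (\<lambda>x. \<rho> x 0)"

definition vbar :: real where
  "vbar = circle_integral (\<lambda>x. \<rho> x 0 * v x 0) / mass"

text \<open>The deviation from the mean velocity.\<close>

definition u :: "real \<Rightarrow> real \<Rightarrow> real" where
  "u x t = v x t - vbar"

text \<open>With \<open>\<theta> = k * \<rho>\<close> and \<open>r = k * (\<rho> u)\<close> the alignment force is \<open>r - u \<theta>\<close>.\<close>

definition \<theta> :: "real \<Rightarrow> real \<Rightarrow> real" where
  "\<theta> = circle_conv k \<rho>"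

definition r :: "real \<Rightarrow> real \<Rightarrow> real" where
  "r = circle_conv k (\<lambda>x t. \<rho> x t * u x t)"

lemma mass_pos: "0 < mass"
  using mass_pos' by (simp add: mass_def)

lemma u_field: "C1_field u vx vt"
  using C1_field_diff[OF v_field C1_field_const[of vbar]] by (simp add: u_def[abs_def])

lemmas rho_cont = C1_fieldD(4)[OF rho_field]
  and v_cont = C1_fieldD(4)[OF v_field]
  and u_cont = C1_fieldD(4)[OF u_field]

lemma rho_u_cont: "spacetime_continuous (\<lambda>x t. \<rho> x t * u x t)"
  by (intro spacetime_continuous_intros rho_cont u_cont)

lemma theta_cont: "spacetime_continuous \<theta>"
  unfolding \<theta>_def by (intro spacetime_continuous_circle_conv k_cont rho_cont)

lemma r_cont: "spacetime_continuous r"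
  unfolding r_def by (intro spacetime_continuous_circle_conv k_cont rho_u_cont)

lemma k_diff_cont: "continuous_on UNIV (\<lambda>y. k (x - y))"
  by (intro continuous_on_compose2[OF k_cont] continuous_intros) auto

lemmas slice_intros = continuous_on_mult continuous_on_add continuous_on_diff continuous_on_minus
  continuous_on_power continuous_on_const k_diff_cont
  rho_cont[THEN spacetime_continuous_slice] v_cont[THEN spacetime_continuous_slice]
  u_cont[THEN spacetime_continuous_slice] theta_cont[THEN spacetime_continuous_slice]
  r_cont[THEN spacetime_continuous_slice]

text \<open>
  Reynolds' transport theorem: integrals against \<open>\<rho>\<close> are differentiated by applying the material
  derivative \<open>\<partial>\<^sub>t + v \<partial>\<^sub>x\<close> to the integrand.
\<close>

lemma transport:
  assumes g: "C1_field g gx gt" and t: "t \<ge> 0"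
  shows "((\<lambda>s. circle_integral (\<lambda>x. \<rho> x s * g x s)) has_real_derivative
           circle_integral (\<lambda>x. \<rho> x t * (gt x t + v x t * gx x t))) (at t within {0..})"
proof -
  note gD = C1_fieldD[OF g] and rD = C1_fieldD[OF rho_field] and vD = C1_fieldD[OF v_field]
  note slice = spacetime_continuous_slice[OF _ t]
  note P = C1_fieldD[OF C1_field_mult[OF rho_field g]]
  \<comment> \<open>The derivative of the flux \<open>v \<rho> g\<close>, which has mean zero by periodicity.\<close>
  define F' where "F' x = (vx x t * \<rho> x t + v x t * \<rho>x x t) * g x t + v x t * \<rho> x t * gx x t" for x
  have "circle_integral F' = 0"
  proof (rule circle_integral_deriv_periodic)
    show "((\<lambda>x. v x t * \<rho> x t * g x t) has_real_derivative F' x) (at x)" for x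
      unfolding F'_def using gD(2)[OF t] rD(2)[OF t] vD(2)[OF t]
      by (auto intro!: derivative_eq_intros simp: algebra_simps)
    show "v (2 * pi) t * \<rho> (2 * pi) t * g (2 * pi) t = v 0 t * \<rho> 0 t * g 0 t"
      using gD(1)[OF t, of 0] rD(1)[OF t, of 0] vD(1)[OF t, of 0] by simp
  qed
  moreover have "circle_integral (\<lambda>x. \<rho>t x t * g x t + \<rho> x t * gt x t) =
      circle_integral (\<lambda>x. \<rho> x t * (gt x t + v x t * gx x t) - F' x)"
  proof -
    have "\<rho>t x t * g x t + \<rho> x t * gt x t = \<rho> x t * (gt x t + v x t * gx x t) - F' x" for x
    proof -
      have "\<rho>t x t = - (vx x t * \<rho> x t + v x t * \<rho>x x t)" using continuity_eq[OF t, of x] by simp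
      then show ?thesis unfolding F'_def by algebra
    qed
    then show ?thesis by simp
  qed
  moreover have "circle_integral (\<lambda>x. \<rho> x t * (gt x t + v x t * gx x t) - F' x) =
      circle_integral (\<lambda>x. \<rho> x t * (gt x t + v x t * gx x t)) - circle_integral F'"
    unfolding F'_def
    by (intro circle_integral_diff slice_intros slice gD rD vD) (use t in auto)
  ultimately show ?thesis
    using field_circle_integral_derivative[OF P(4,6) P(3) t] by simp
qed

lemma mass_conserved:
  assumes t: "t \<ge> 0"
  shows "circle_integral (\<lambda>x. \<rho> x t) = mass"
proof -
  have "\<exists>c. \<forall>s\<in>{0..}. circle_integral (\<lambda>x. \<rho> x s) = c"
    using transport[OF C1_field_const[of 1]]
    by (intro has_field_derivative_zero_constant) (auto simp: circle_integral_const)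
  with t show ?thesis by (force simp: mass_def)
qed

lemma velocity_eq:
  assumes t: "t \<ge> 0"
  shows "vt x t + v x t * vx x t = r x t - u x t * \<theta> x t"
proof -
  have "circle_integral (\<lambda>y. k (x - y) * (v y t - v x t) * \<rho> y t) =
        circle_integral (\<lambda>y. k (x - y) * (\<rho> y t * u y t) - u x t * (k (x - y) * \<rho> y t))"
    by (rule arg_cong[of _ _ circle_integral]) (auto simp: u_def algebra_simps)
  also have "\<dots> = circle_integral (\<lambda>y. k (x - y) * (\<rho> y t * u y t)) -
       circle_integral (\<lambda>y. u x t * (k (x - y) * \<rho> y t))"
    by (intro circle_integral_diff slice_intros t)
  finally show ?thesis
    using momentum_eq[OF t] by (simp add: r_def \<theta>_def circle_conv_def circle_integral_cmult)
qed

lemma force_mean_zero: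
  assumes t: "t \<ge> 0"
  shows "circle_integral (\<lambda>x. \<rho> x t * (r x t - u x t * \<theta> x t)) = 0"
proof -
  have "circle_integral (\<lambda>x. \<rho> x t * r x t) = circle_integral (\<lambda>x. (\<rho> x t * u x t) * \<theta> x t)"
    unfolding r_def \<theta>_def circle_conv_def
    by (intro circle_integral_conv_symmetric k_cont k_even slice_intros t)
  moreover have "circle_integral (\<lambda>x. \<rho> x t * r x t - (\<rho> x t * u x t) * \<theta> x t) =
      circle_integral (\<lambda>x. \<rho> x t * r x t) - circle_integral (\<lambda>x. (\<rho> x t * u x t) * \<theta> x t)"
    by (intro circle_integral_diff slice_intros t)
  ultimately show ?thesis by (simp add: algebra_simps)
qed

lemma momentum_conserved:
  assumes t: "t \<ge> 0"
  shows "circle_integral (\<lambda>x. \<rho> x t * v x t) = vbar * mass"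
proof -
  have "\<exists>c. \<forall>s\<in>{0..}. circle_integral (\<lambda>x. \<rho> x s * v x s) = c"
    using transport[OF v_field] force_mean_zero
    by (intro has_field_derivative_zero_constant) (auto simp: velocity_eq)
  with t mass_pos show ?thesis by (force simp: vbar_def)
qed

lemma mean_velocity_eq:
  assumes t: "t \<ge> 0"
  shows "mean_velocity \<rho> v t = vbar"
  using momentum_conserved[OF t] mass_conserved[OF t] mass_pos
  by (simp add: mean_velocity_def total_mass_def mult.commute)

section \<open>The corrector\<close>

text \<open>
  \<open>\<eta>\<close> is a primitive of \<open>1 - \<kappa> k\<close>, where \<open>\<kappa>\<close> is chosen such that this function has mean
  zero; hence \<open>\<eta>\<close> is periodic.
\<close>

definition \<kappa> :: real where
  "\<kappa> = 2 * pi / circle_integral k"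

definition \<eta> :: "real \<Rightarrow> real" where
  "\<eta> = (SOME h. \<forall>z. (h has_real_derivative 1 - \<kappa> * k z) (at z))"

lemma kappa_pos: "0 < \<kappa>"
  using k_int by (simp add: \<kappa>_def)

lemma eta_deriv: "(\<eta> has_real_derivative 1 - \<kappa> * k z) (at z)"
proof -
  have "isCont (\<lambda>z. 1 - \<kappa> * k z) x" for x
    using k_cont by (intro continuous_intros) (simp add: continuous_on_eq_continuous_at)
  then have "\<exists>h. \<forall>z. (h has_real_derivative 1 - \<kappa> * k z) (at z)"
    using einterval_antiderivative[of "-\<infinity>" "\<infinity>" "\<lambda>z. 1 - \<kappa> * k z"]
    by (simp add: has_real_derivative_iff_has_vector_derivative)
  from someI_ex[OF this] show ?thesis unfolding \<eta>_def by blast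
qed

lemma eta_cont: "continuous_on UNIV \<eta>"
  using eta_deriv by (meson DERIV_isCont continuous_at_imp_continuous_on)

lemma eta'_cont: "continuous_on UNIV (\<lambda>z. 1 - \<kappa> * k z)"
  using k_cont by (intro continuous_intros)

lemma eta_per: "\<eta> (z + 2 * pi) = \<eta> z"
proof -
  have "((\<lambda>z. 1 - \<kappa> * k z) has_integral \<eta> (2 * pi) - \<eta> 0) {0..2 * pi}"
    using eta_deriv
    by (intro fundamental_theorem_of_calculus)
      (auto simp flip: has_real_derivative_iff_has_vector_derivative
        intro: has_field_derivative_at_within)
  then have "\<eta> (2 * pi) - \<eta> 0 = circle_integral (\<lambda>z. 1 - \<kappa> * k z)"
    by (simp add: circle_integral_def integral_unique)
  also have "\<dots> = circle_integral (\<lambda>z. 1) - circle_integral (\<lambda>z. \<kappa> * k z)"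
    by (intro circle_integral_diff continuous_intros k_cont)
  also have "\<dots> = 0"
    using k_int by (simp only: circle_integral_const circle_integral_cmult) (simp add: \<kappa>_def)
  finally have 0: "\<eta> (2 * pi) - \<eta> 0 = 0" .
  have "((\<lambda>z. \<eta> (z + 2 * pi) - \<eta> z) has_real_derivative 0) (at z)" for z
  proof -
    have "((\<lambda>z. \<eta> (z + 2 * pi)) has_real_derivative 1 - \<kappa> * k (z + 2 * pi)) (at z)"
      using eta_deriv[of "z + 2 * pi"] DERIV_shift by blast
    from DERIV_diff[OF this eta_deriv] show ?thesis by (simp add: k_per)
  qed
  then have "\<eta> (z + 2 * pi) - \<eta> z = \<eta> (0 + 2 * pi) - \<eta> 0"
    by (intro DERIV_isconst_all) auto
  with 0 show ?thesis by simp
qed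

text \<open>The corrector and its partial derivatives.\<close>

definition \<Psi> :: "real \<Rightarrow> real \<Rightarrow> real" where
  "\<Psi> = circle_conv \<eta> \<rho>"

definition \<Psi>x :: "real \<Rightarrow> real \<Rightarrow> real" where
  "\<Psi>x = circle_conv (\<lambda>z. 1 - \<kappa> * k z) \<rho>"

definition \<Psi>t :: "real \<Rightarrow> real \<Rightarrow> real" where
  "\<Psi>t x t = - circle_conv (\<lambda>z. 1 - \<kappa> * k z) (\<lambda>x t. v x t * \<rho> x t) x t"

lemma eta_diff_cont: "continuous_on UNIV (\<lambda>y. \<eta> (x - y))"
  by (intro continuous_on_compose2[OF eta_cont] continuous_intros) auto

lemma Psi_deriv_x:
  assumes t: "t \<ge> 0"
  shows "((\<lambda>x. \<Psi> x t) has_real_derivative \<Psi>x x t) (at x)"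
proof -
  have "((\<lambda>x. integral (cbox 0 (2 * pi)) (\<lambda>y. \<eta> (x - y) * \<rho> y t)) has_real_derivative
       integral (cbox 0 (2 * pi)) (\<lambda>y. (1 - \<kappa> * k (x - y)) * \<rho> y t)) (at x within UNIV)"
  proof (rule leibniz_rule_field_derivative)
    show "((\<lambda>x. \<eta> (x - y) * \<rho> y t) has_real_derivative (1 - \<kappa> * k (x - y)) * \<rho> y t)
        (at x within UNIV)" for x y
      by (intro DERIV_cmult_right DERIV_chain2[OF eta_deriv, THEN DERIV_cong] derivative_eq_intros)
        auto
    show "(\<lambda>y. \<eta> (x - y) * \<rho> y t) integrable_on cbox 0 (2 * pi)" for x
      unfolding cbox_interval
      by (intro circle_integrable slice_intros eta_diff_cont t)
    show "continuous_on (UNIV \<times> cbox 0 (2 * pi)) (\<lambda>(x, y). (1 - \<kappa> * k (x - y)) * \<rho> y t)"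
      unfolding split_beta using t
      by (intro continuous_on_mult continuous_on_compose2[OF eta'_cont]
          spacetime_continuous_comp[OF rho_cont] continuous_intros) auto
  qed auto
  then show ?thesis
    by (simp add: \<Psi>_def \<Psi>x_def circle_conv_def[abs_def] circle_integral_def cbox_interval)
qed

text \<open>The continuity equation and an integration by parts move the derivative onto \<open>\<eta>\<close>.\<close>

lemma Psi_deriv_t:
  assumes t: "t \<ge> 0"
  shows "((\<lambda>s. \<Psi> x s) has_real_derivative \<Psi>t x t) (at t within {0..})"
proof -
  note rD = C1_fieldD[OF rho_field] and vD = C1_fieldD[OF v_field]
  note slice = spacetime_continuous_slice[OF _ t]
  have eta_st: "spacetime_continuous (\<lambda>y t. \<eta> (x - y))"
    unfolding spacetime_continuous_def
    by (intro continuous_on_compose2[OF eta_cont] continuous_intros) auto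
  have der: "((\<lambda>s. circle_integral (\<lambda>y. \<eta> (x - y) * \<rho> y s)) has_real_derivative
      circle_integral (\<lambda>y. \<eta> (x - y) * \<rho>t y t)) (at t within {0..})"
    by (rule field_circle_integral_derivative)
      (intro spacetime_continuous_intros eta_st rD DERIV_cmult t | assumption)+
  \<comment> \<open>The derivative of \<open>y \<mapsto> \<eta> (x - y) v y \<rho> y\<close>.\<close>
  define F' where "F' y = \<eta> (x - y) * (vx y t * \<rho> y t + v y t * \<rho>x y t) -
      (1 - \<kappa> * k (x - y)) * (v y t * \<rho> y t)" for y
  have "circle_integral F' = 0"
  proof (rule circle_integral_deriv_periodic)
    fix y
    have "((\<lambda>y. \<eta> (x - y)) has_real_derivative - (1 - \<kappa> * k (x - y))) (at y)"
      by (intro DERIV_chain2[OF eta_deriv, THEN DERIV_cong] derivative_eq_intros) auto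
    then show "((\<lambda>y. \<eta> (x - y) * (v y t * \<rho> y t)) has_real_derivative F' y) (at y)"
      unfolding F'_def using rD(2)[OF t] vD(2)[OF t]
      by (auto intro!: derivative_eq_intros simp: algebra_simps)
  next
    show "\<eta> (x - 2 * pi) * (v (2 * pi) t * \<rho> (2 * pi) t) = \<eta> (x - 0) * (v 0 t * \<rho> 0 t)"
      using rD(1)[OF t, of 0] vD(1)[OF t, of 0] eta_per[of "x - 2 * pi"] by simp
  qed
  moreover have "circle_integral (\<lambda>y. \<eta> (x - y) * \<rho>t y t) =
      circle_integral (\<lambda>y. - ((1 - \<kappa> * k (x - y)) * (v y t * \<rho> y t)) - F' y)"
  proof -
    have "\<eta> (x - y) * \<rho>t y t = - ((1 - \<kappa> * k (x - y)) * (v y t * \<rho> y t)) - F' y" for y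
    proof -
      have "\<rho>t y t = - (vx y t * \<rho> y t + v y t * \<rho>x y t)" using continuity_eq[OF t, of y] by simp
      then show ?thesis unfolding F'_def by algebra
    qed
    then show ?thesis by simp
  qed
  moreover have "circle_integral (\<lambda>y. - ((1 - \<kappa> * k (x - y)) * (v y t * \<rho> y t)) - F' y) =
      circle_integral (\<lambda>y. - ((1 - \<kappa> * k (x - y)) * (v y t * \<rho> y t))) - circle_integral F'"
    unfolding F'_def
    by (intro circle_integral_diff slice_intros eta_diff_cont slice rD vD t)
  ultimately show ?thesis
    using der by (simp add: \<Psi>_def \<Psi>t_def circle_conv_def circle_integral_uminus)
qed

lemma Psi_field: "C1_field \<Psi> \<Psi>x \<Psi>t"
  unfolding C1_field_def
proof (intro conjI allI impI)
  show "\<Psi> (x + 2 * pi) t = \<Psi> x t" for x t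
    using eta_per[of "x - y" for y] by (simp add: \<Psi>_def circle_conv_def algebra_simps)
  show "spacetime_continuous \<Psi>" "spacetime_continuous \<Psi>x" "spacetime_continuous \<Psi>t"
    unfolding \<Psi>_def \<Psi>x_def \<Psi>t_def[abs_def]
    by (intro spacetime_continuous_intros spacetime_continuous_circle_conv eta_cont eta'_cont
        rho_cont v_cont)+
qed (simp_all add: Psi_deriv_x Psi_deriv_t)

text \<open>
  The material derivative of the corrector has the coercive term \<open>mass * u\<close>; what is left is a
  multiple of the alignment force.
\<close>

lemma Psi_material_derivative:
  assumes t: "t \<ge> 0"
  shows "\<Psi>t x t + v x t * \<Psi>x x t = mass * u x t - \<kappa> * (u x t * \<theta> x t - r x t)"
proof -
  have "\<Psi>x x t = circle_integral (\<lambda>y. \<rho> y t - \<kappa> * (k (x - y) * \<rho> y t))"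
    by (simp add: \<Psi>x_def circle_conv_def algebra_simps)
  also have "\<dots> = circle_integral (\<lambda>y. \<rho> y t) - circle_integral (\<lambda>y. \<kappa> * (k (x - y) * \<rho> y t))"
    by (intro circle_integral_diff slice_intros t)
  finally have x: "\<Psi>x x t = mass - \<kappa> * \<theta> x t"
    by (simp add: mass_conserved[OF t] circle_integral_cmult \<theta>_def circle_conv_def)
  have "- \<Psi>t x t = circle_integral (\<lambda>y. \<rho> y t * v y t -
      \<kappa> * (k (x - y) * (\<rho> y t * u y t) + vbar * (k (x - y) * \<rho> y t)))"
    by (simp add: \<Psi>t_def circle_conv_def u_def algebra_simps)
  also have "\<dots> = circle_integral (\<lambda>y. \<rho> y t * v y t) - circle_integral (\<lambda>y.
      \<kappa> * (k (x - y) * (\<rho> y t * u y t) + vbar * (k (x - y) * \<rho> y t)))"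
    by (intro circle_integral_diff slice_intros t)
  also have "circle_integral (\<lambda>y. \<kappa> * (k (x - y) * (\<rho> y t * u y t) + vbar * (k (x - y) * \<rho> y t))) =
      \<kappa> * (circle_integral (\<lambda>y. k (x - y) * (\<rho> y t * u y t)) +
           circle_integral (\<lambda>y. vbar * (k (x - y) * \<rho> y t)))"
    unfolding circle_integral_cmult[of \<kappa>]
    by (rule arg_cong[of _ _ "\<lambda>c. \<kappa> * c"]) (intro circle_integral_add slice_intros t)
  finally have "\<Psi>t x t = - (vbar * mass - \<kappa> * (r x t + vbar * \<theta> x t))"
    by (simp add: momentum_conserved[OF t] circle_integral_cmult r_def \<theta>_def circle_conv_def)
  then show ?thesis unfolding x by (simp add: u_def algebra_simps)
qed

section \<open>Uniform bounds\<close>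

lemma theta_nonneg:
  assumes t: "t \<ge> 0"
  shows "0 \<le> \<theta> x t"
  unfolding \<theta>_def circle_conv_def
  by (intro circle_integral_nonneg slice_intros t mult_nonneg_nonneg k_nonneg rho_nonneg)

lemma Psi_bounded: obtains P where "P > 0" "\<And>x t. t \<ge> 0 \<Longrightarrow> \<bar>\<Psi> x t\<bar> \<le> P"
proof -
  obtain K where K: "K > 0" "\<And>x. \<bar>\<eta> x\<bar> \<le> K"
    using periodic_bounded[OF eta_cont eta_per] by blast
  have "\<bar>\<Psi> x t\<bar> \<le> K * mass" if t: "t \<ge> 0" for x t
  proof -
    have "\<bar>\<Psi> x t\<bar> \<le> circle_integral (\<lambda>y. K * \<rho> y t)"
      unfolding \<Psi>_def circle_conv_def using K rho_nonneg[OF t]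
      by (intro abs_circle_integral_le slice_intros eta_diff_cont t)
        (auto simp: abs_mult intro!: mult_mono)
    then show ?thesis by (simp only: circle_integral_cmult mass_conserved[OF t])
  qed
  moreover have "K * mass > 0" using K mass_pos by simp
  ultimately show ?thesis using that by blast
qed

text \<open>
  Since \<open>\<kappa> u - \<Psi>\<close> has material derivative \<open>- mass * u\<close> and \<open>\<Psi>\<close> is bounded, \<open>\<kappa> \<bar>u\<bar>\<close> cannot grow
  beyond a constant.
\<close>

lemma u_bounded: obtains U where "U > 0" "\<And>x t. t \<ge> 0 \<Longrightarrow> \<bar>u x t\<bar> \<le> U"
proof -
  obtain P where P: "P > 0" "\<And>x t. t \<ge> 0 \<Longrightarrow> \<bar>\<Psi> x t\<bar> \<le> P"
    using Psi_bounded by blast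
  have slice0: "continuous_on UNIV (\<lambda>x. u x 0)"
    using spacetime_continuous_slice[OF u_cont] by simp
  obtain U0 where U0: "U0 > 0" "\<And>x. \<bar>u x 0\<bar> \<le> U0"
    using periodic_bounded[OF slice0] C1_fieldD(1)[OF u_field, of 0] by auto
  \<comment> \<open>Upper and lower bound together, with \<open>s = 1\<close> and \<open>s = - 1\<close>.\<close>
  have main: "\<kappa> * (s * u x t) \<le> \<kappa> * U0 + 2 * P + 1" if s: "s\<^sup>2 = 1" and t: "t \<ge> 0" for s x t
  proof -
    have abs_s: "\<bar>s\<bar> = 1" using s by (simp add: abs_square_eq_1)
    have W: "C1_field (\<lambda>x t. \<kappa> * (s * u x t) - s * \<Psi> x t) (\<lambda>x t. \<kappa> * (s * vx x t) - s * \<Psi>x x t)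
        (\<lambda>x t. \<kappa> * (s * vt x t) - s * \<Psi>t x t)"
      by (intro C1_field_diff C1_field_cmult u_field Psi_field)
    have "\<kappa> * (s * u x t) - s * \<Psi> x t < \<kappa> * U0 + P + 1"
    proof (rule C1_field_below_barrier[OF W, of 0 "\<lambda>t. \<kappa> * U0 + P + 1" "\<lambda>t. 0"])
      show "((\<lambda>t. \<kappa> * U0 + P + 1) has_real_derivative 0) (at t)" for t by simp
      show "\<kappa> * (s * u x 0) - s * \<Psi> x 0 < \<kappa> * U0 + P + 1" for x
      proof -
        have "s * u x 0 \<le> U0" using U0(2)[of x] abs_s abs_mult[of s "u x 0"] by simp
        then have "\<kappa> * (s * u x 0) \<le> \<kappa> * U0" using kappa_pos by simp
        moreover have "\<bar>s * \<Psi> x 0\<bar> \<le> P" using P(2)[of 0 x] abs_s by (simp add: abs_mult)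
        ultimately show ?thesis by linarith
      qed
    next
      fix x t :: real
      assume t: "t > 0" and touch: "\<kappa> * (s * u x t) - s * \<Psi> x t = \<kappa> * U0 + P + 1"
        and x: "\<kappa> * (s * vx x t) - s * \<Psi>x x t = 0"
      have t0: "t \<ge> 0" using t by simp
      have "\<bar>s * \<Psi> x t\<bar> \<le> P" using P(2)[OF t0, of x] abs_s by (simp add: abs_mult)
      moreover have "0 \<le> \<kappa> * U0" using kappa_pos U0 by simp
      ultimately have "0 < \<kappa> * (s * u x t)" using touch by linarith
      then have "0 < s * u x t" using kappa_pos by (simp add: zero_less_mult_iff)
      moreover have "\<kappa> * (s * vt x t) - s * \<Psi>t x t = - mass * (s * u x t)"
        using velocity_eq[OF t0, of x] Psi_material_derivative[OF t0, of x] x by algebra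
      ultimately show "\<kappa> * (s * vt x t) - s * \<Psi>t x t < 0" using mass_pos by simp
    qed (use t in auto)
    moreover have "\<bar>s * \<Psi> x t\<bar> \<le> P" using P(2)[OF t, of x] abs_s by (simp add: abs_mult)
    ultimately show ?thesis by linarith
  qed
  have "\<bar>u x t\<bar> \<le> (\<kappa> * U0 + 2 * P + 1) / \<kappa>" if "t \<ge> 0" for x t
    using main[of 1 t x] main[of "-1" t x] that kappa_pos by (simp add: field_simps abs_le_iff)
  moreover have "(\<kappa> * U0 + 2 * P + 1) / \<kappa> > 0"
    using kappa_pos U0 P by (intro divide_pos_pos add_pos_pos mult_pos_pos) auto
  ultimately show ?thesis using that by blast
qed

section \<open>Decay of the energy\<close>

text \<open>The energy of the velocity fluctuations.\<close>

definition E :: "real \<Rightarrow> real" where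
  "E t = circle_integral (\<lambda>x. \<rho> x t * (u x t * u x t))"

text \<open>
  The dissipation \<open>\<integral>\<integral> k (x - y) (u y - u x)\<^sup>2 \<rho> y \<rho> x\<close>, with the inner integral as a density with
  respect to \<open>\<rho>\<close>.
\<close>

definition dens :: "real \<Rightarrow> real \<Rightarrow> real" where
  "dens x t = circle_integral (\<lambda>y. k (x - y) * ((u y t - u x t)\<^sup>2 * \<rho> y t))"

definition Diss :: "real \<Rightarrow> real" where
  "Diss t = circle_integral (\<lambda>x. \<rho> x t * dens x t)"

text \<open>The correlation of velocity and corrector.\<close>

definition G :: "real \<Rightarrow> real" where
  "G t = circle_integral (\<lambda>x. \<rho> x t * (u x t * \<Psi> x t))"

lemma dens_eq:
  assumes t: "t \<ge> 0"
  shows "dens x t = circle_conv k (\<lambda>x t. \<rho> x t * (u x t * u x t)) x t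
           - 2 * u x t * r x t + (u x t)\<^sup>2 * \<theta> x t"
proof -
  have "dens x t = circle_integral (\<lambda>y. k (x - y) * (\<rho> y t * (u y t * u y t))
      - 2 * u x t * (k (x - y) * (\<rho> y t * u y t)) + (u x t)\<^sup>2 * (k (x - y) * \<rho> y t))"
    unfolding dens_def
    by (rule arg_cong[of _ _ circle_integral]) (auto simp: algebra_simps power2_eq_square)
  also have "\<dots> = circle_integral (\<lambda>y. k (x - y) * (\<rho> y t * (u y t * u y t))
      - 2 * u x t * (k (x - y) * (\<rho> y t * u y t))) +
      circle_integral (\<lambda>y. (u x t)\<^sup>2 * (k (x - y) * \<rho> y t))"
    by (intro circle_integral_add slice_intros t)
  also have "circle_integral (\<lambda>y. k (x - y) * (\<rho> y t * (u y t * u y t))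
      - 2 * u x t * (k (x - y) * (\<rho> y t * u y t))) =
      circle_integral (\<lambda>y. k (x - y) * (\<rho> y t * (u y t * u y t))) -
      circle_integral (\<lambda>y. 2 * u x t * (k (x - y) * (\<rho> y t * u y t)))"
    by (intro circle_integral_diff slice_intros t)
  finally show ?thesis
    by (simp only: circle_integral_cmult circle_conv_def r_def \<theta>_def)
qed

lemma rho_uu_cont: "spacetime_continuous (\<lambda>x t. \<rho> x t * (u x t * u x t))"
  by (intro spacetime_continuous_intros rho_cont u_cont)

lemma dens_cont:
  assumes t: "t \<ge> 0"
  shows "continuous_on UNIV (\<lambda>x. dens x t)"
  unfolding dens_eq[OF t]
  by (intro slice_intros spacetime_continuous_slice[OF spacetime_continuous_circle_conv]
      k_cont rho_uu_cont t)

lemma dens_nonneg: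
  assumes t: "t \<ge> 0"
  shows "0 \<le> dens x t"
  unfolding dens_def
  by (intro circle_integral_nonneg slice_intros t mult_nonneg_nonneg k_nonneg rho_nonneg
      zero_le_power2)

lemma Diss_nonneg:
  assumes t: "t \<ge> 0"
  shows "0 \<le> Diss t"
  unfolding Diss_def
  by (intro circle_integral_nonneg slice_intros dens_cont t mult_nonneg_nonneg dens_nonneg
      rho_nonneg)

lemma E_nonneg:
  assumes t: "t \<ge> 0"
  shows "0 \<le> E t"
  unfolding E_def
  by (intro circle_integral_nonneg slice_intros t mult_nonneg_nonneg rho_nonneg zero_le_square)

lemma Psi_slice: "t \<ge> 0 \<Longrightarrow> continuous_on UNIV (\<lambda>x. \<Psi> x t)"
  by (rule spacetime_continuous_slice[OF C1_fieldD(4)[OF Psi_field]])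

text \<open>The evenness of \<open>k\<close> makes the work of the alignment force minus half of the dissipation.\<close>

lemma force_work:
  assumes t: "t \<ge> 0"
  shows "circle_integral (\<lambda>x. \<rho> x t * (u x t * (u x t * \<theta> x t - r x t))) = Diss t / 2"
proof -
  let ?c = "circle_conv k (\<lambda>x t. \<rho> x t * (u x t * u x t))"
  have c_slice: "continuous_on UNIV (\<lambda>x. ?c x t)"
    by (intro spacetime_continuous_slice[OF spacetime_continuous_circle_conv] k_cont rho_uu_cont t)
  have sym: "circle_integral (\<lambda>x. \<rho> x t * ?c x t) =
      circle_integral (\<lambda>x. (\<rho> x t * (u x t * u x t)) * \<theta> x t)"
    unfolding \<theta>_def circle_conv_def
    by (intro circle_integral_conv_symmetric k_cont k_even slice_intros t)
  have "Diss t = circle_integral (\<lambda>x. (\<rho> x t * ?c x t - (\<rho> x t * (u x t * u x t)) * \<theta> x t) +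
      2 * (\<rho> x t * (u x t * (u x t * \<theta> x t - r x t))))"
    unfolding Diss_def dens_eq[OF t]
    by (rule arg_cong[of _ _ circle_integral]) (auto simp: algebra_simps power2_eq_square)
  also have "\<dots> = circle_integral (\<lambda>x. \<rho> x t * ?c x t - (\<rho> x t * (u x t * u x t)) * \<theta> x t) +
      circle_integral (\<lambda>x. 2 * (\<rho> x t * (u x t * (u x t * \<theta> x t - r x t))))"
    by (intro circle_integral_add slice_intros c_slice t)
  also have "circle_integral (\<lambda>x. \<rho> x t * ?c x t - (\<rho> x t * (u x t * u x t)) * \<theta> x t) =
      circle_integral (\<lambda>x. \<rho> x t * ?c x t) -
      circle_integral (\<lambda>x. (\<rho> x t * (u x t * u x t)) * \<theta> x t)"
    by (intro circle_integral_diff slice_intros c_slice t)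
  finally show ?thesis unfolding sym circle_integral_cmult by linarith
qed

lemma E_deriv:
  assumes t: "t \<ge> 0"
  shows "(E has_real_derivative - Diss t) (at t within {0..})"
proof -
  have "circle_integral (\<lambda>x. \<rho> x t * ((vt x t * u x t + u x t * vt x t)
      + v x t * (vx x t * u x t + u x t * vx x t))) =
      circle_integral (\<lambda>x. - 2 * (\<rho> x t * (u x t * (u x t * \<theta> x t - r x t))))"
  proof (rule arg_cong[of _ _ circle_integral], rule ext)
    fix x
    show "\<rho> x t * ((vt x t * u x t + u x t * vt x t) + v x t * (vx x t * u x t + u x t * vx x t))
        = - 2 * (\<rho> x t * (u x t * (u x t * \<theta> x t - r x t)))"
      using velocity_eq[OF t, of x] by algebra
  qed
  also have "\<dots> = - Diss t"
    by (simp only: circle_integral_cmult force_work[OF t])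
  finally show ?thesis
    using transport[OF C1_field_mult[OF u_field u_field] t] by (simp add: E_def[abs_def])
qed

lemma G_deriv:
  assumes t: "t \<ge> 0"
  shows "(G has_real_derivative mass * E t - \<kappa> * (Diss t / 2) +
      circle_integral (\<lambda>x. \<rho> x t * \<Psi> x t * (r x t - u x t * \<theta> x t))) (at t within {0..})"
proof -
  note slices = slice_intros Psi_slice t
  have "circle_integral (\<lambda>x. \<rho> x t * ((vt x t * \<Psi> x t + u x t * \<Psi>t x t)
      + v x t * (vx x t * \<Psi> x t + u x t * \<Psi>x x t))) =
      circle_integral (\<lambda>x. mass * (\<rho> x t * (u x t * u x t))
        - \<kappa> * (\<rho> x t * (u x t * (u x t * \<theta> x t - r x t)))
        + \<rho> x t * \<Psi> x t * (r x t - u x t * \<theta> x t))"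
  proof (rule arg_cong[of _ _ circle_integral], rule ext)
    fix x
    show "\<rho> x t * ((vt x t * \<Psi> x t + u x t * \<Psi>t x t) + v x t * (vx x t * \<Psi> x t + u x t * \<Psi>x x t))
      = mass * (\<rho> x t * (u x t * u x t)) - \<kappa> * (\<rho> x t * (u x t * (u x t * \<theta> x t - r x t)))
        + \<rho> x t * \<Psi> x t * (r x t - u x t * \<theta> x t)"
      using velocity_eq[OF t, of x] Psi_material_derivative[OF t, of x] by algebra
  qed
  also have "\<dots> = circle_integral (\<lambda>x. mass * (\<rho> x t * (u x t * u x t))
        - \<kappa> * (\<rho> x t * (u x t * (u x t * \<theta> x t - r x t))))
        + circle_integral (\<lambda>x. \<rho> x t * \<Psi> x t * (r x t - u x t * \<theta> x t))"
    by (intro circle_integral_add slices)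
  also have "circle_integral (\<lambda>x. mass * (\<rho> x t * (u x t * u x t))
        - \<kappa> * (\<rho> x t * (u x t * (u x t * \<theta> x t - r x t)))) =
      circle_integral (\<lambda>x. mass * (\<rho> x t * (u x t * u x t)))
        - circle_integral (\<lambda>x. \<kappa> * (\<rho> x t * (u x t * (u x t * \<theta> x t - r x t))))"
    by (intro circle_integral_diff slices)
  finally show ?thesis
    using transport[OF C1_field_mult[OF u_field Psi_field] t]
    by (simp only: circle_integral_cmult force_work[OF t] E_def G_def[abs_def])
qed

text \<open>Young's inequality in the force; the free weight \<open>e\<close> later becomes the energy itself.\<close>

lemma force_le:
  assumes t: "t \<ge> 0" and e: "e \<ge> 0" and \<mu>: "\<mu> > 0"
  shows "e * \<bar>r x t - u x t * \<theta> x t\<bar> \<le> \<mu> * e\<^sup>2 * \<theta> x t + dens x t / (4 * \<mu>)"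
proof -
  have "r x t - u x t * \<theta> x t =
      circle_integral (\<lambda>y. k (x - y) * (\<rho> y t * u y t)) -
      circle_integral (\<lambda>y. u x t * (k (x - y) * \<rho> y t))"
    by (simp add: r_def \<theta>_def circle_conv_def circle_integral_cmult)
  also have "\<dots> = circle_integral (\<lambda>y. k (x - y) * (\<rho> y t * u y t) - u x t * (k (x - y) * \<rho> y t))"
    by (intro circle_integral_diff[symmetric] slice_intros t)
  also have "\<dots> = circle_integral (\<lambda>y. k (x - y) * \<rho> y t * (u y t - u x t))"
    by (simp add: algebra_simps)
  finally have force: "r x t - u x t * \<theta> x t =
      circle_integral (\<lambda>y. k (x - y) * \<rho> y t * (u y t - u x t))" .
  have "e * \<bar>r x t - u x t * \<theta> x t\<bar> =
      \<bar>circle_integral (\<lambda>y. e * (k (x - y) * \<rho> y t * (u y t - u x t)))\<bar>"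
    unfolding circle_integral_cmult force using e by (simp add: abs_mult)
  also have "\<dots> \<le> circle_integral (\<lambda>y. \<mu> * e\<^sup>2 * (k (x - y) * \<rho> y t) +
      (1 / (4 * \<mu>)) * (k (x - y) * ((u y t - u x t)\<^sup>2 * \<rho> y t)))"
  proof (intro abs_circle_integral_le slice_intros t)
    fix y
    let ?d = "u y t - u x t"
    have "0 \<le> (2 * \<mu> * e - \<bar>?d\<bar>)\<^sup>2 / (4 * \<mu>)" using \<mu> by simp
    also have "\<dots> = \<mu> * e\<^sup>2 + ?d\<^sup>2 / (4 * \<mu>) - e * \<bar>?d\<bar>"
      using \<mu> by (simp add: field_simps power2_diff power2_eq_square)
    finally have young: "e * \<bar>?d\<bar> \<le> \<mu> * e\<^sup>2 + ?d\<^sup>2 / (4 * \<mu>)" by simp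
    have kr: "0 \<le> k (x - y) * \<rho> y t" using k_nonneg rho_nonneg[OF t] by simp
    have "\<bar>e * (k (x - y) * \<rho> y t * ?d)\<bar> = (k (x - y) * \<rho> y t) * (e * \<bar>?d\<bar>)"
      using kr e k_nonneg[of "x - y"] rho_nonneg[OF t, of y] by (simp add: abs_mult)
    also have "\<dots> \<le> (k (x - y) * \<rho> y t) * (\<mu> * e\<^sup>2 + ?d\<^sup>2 / (4 * \<mu>))"
      using young kr by (rule mult_left_mono)
    finally show "\<bar>e * (k (x - y) * \<rho> y t * ?d)\<bar> \<le> \<mu> * e\<^sup>2 * (k (x - y) * \<rho> y t) +
      (1 / (4 * \<mu>)) * (k (x - y) * (?d\<^sup>2 * \<rho> y t))"
      by (simp add: algebra_simps)
  qed
  also have "\<dots> = circle_integral (\<lambda>y. \<mu> * e\<^sup>2 * (k (x - y) * \<rho> y t)) +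
      circle_integral (\<lambda>y. (1 / (4 * \<mu>)) * (k (x - y) * ((u y t - u x t)\<^sup>2 * \<rho> y t)))"
    by (intro circle_integral_add slice_intros t)
  also have "\<dots> = \<mu> * e\<^sup>2 * \<theta> x t + (1 / (4 * \<mu>)) * dens x t"
    by (simp only: circle_integral_cmult \<theta>_def circle_conv_def dens_def)
  finally show ?thesis by simp
qed

text \<open>
  The Lyapunov functional is \<open>E - \<epsilon> E G\<close>: the coercive part of \<open>G'\<close> contributes \<open>- \<epsilon> mass E\<^sup>2\<close>,
  and all the other terms are absorbed by the dissipation and by half of this one.
\<close>

lemma energy_decay: obtains C where "C > 0" "\<And>t. t > 0 \<Longrightarrow> E t \<le> C / t"
proof -
  obtain P where P: "P > 0" "\<And>x t. t \<ge> 0 \<Longrightarrow> \<bar>\<Psi> x t\<bar> \<le> P"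
    using Psi_bounded by blast
  obtain U where U: "U > 0" "\<And>x t. t \<ge> 0 \<Longrightarrow> \<bar>u x t\<bar> \<le> U"
    using u_bounded by blast
  obtain kb where kb: "kb > 0" "\<And>z. \<bar>k z\<bar> \<le> kb"
    using periodic_bounded[OF k_cont k_per] by blast
  have theta_le: "\<theta> x t \<le> kb * mass" if t: "t \<ge> 0" for x t
  proof -
    have "\<theta> x t \<le> circle_integral (\<lambda>y. kb * \<rho> y t)"
      unfolding \<theta>_def circle_conv_def using kb(2) rho_nonneg[OF t]
      by (intro circle_integral_mono slice_intros t) (auto intro!: mult_right_mono simp: abs_le_iff)
    then show ?thesis by (simp only: circle_integral_cmult mass_conserved[OF t])
  qed
  have E_le: "E t \<le> mass * U\<^sup>2" if t: "t \<ge> 0" for t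
  proof -
    have "E t \<le> circle_integral (\<lambda>x. \<rho> x t * U\<^sup>2)"
      unfolding E_def
    proof (intro circle_integral_mono slice_intros t mult_left_mono rho_nonneg)
      fix x
      show "u x t * u x t \<le> U\<^sup>2"
        using power_mono[OF U(2)[OF t, of x], of 2] by (simp add: power2_eq_square)
    qed
    then show ?thesis by (simp only: circle_integral_cmult_right mass_conserved[OF t])
  qed
  define G0 where "G0 = mass * (U * P)"
  have G_le: "\<bar>G t\<bar> \<le> G0" if t: "t \<ge> 0" for t
  proof -
    have "\<bar>G t\<bar> \<le> circle_integral (\<lambda>x. \<rho> x t * (U * P))"
      unfolding G_def using rho_nonneg[OF t] U P t
      by (intro abs_circle_integral_le slice_intros Psi_slice t)
        (auto simp: abs_mult intro!: mult_mono mult_nonneg_nonneg)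
    then show ?thesis by (simp only: circle_integral_cmult_right mass_conserved[OF t] G0_def)
  qed
  \<comment> \<open>The weight in Young's inequality for which half of the coercive term survives.\<close>
  define \<mu> where "\<mu> = 1 / (2 * P * kb * mass)"
  define C1 where "C1 = P / (4 * \<mu>)"
  have \<mu>: "\<mu> > 0" using P kb mass_pos by (simp add: \<mu>_def)
  have C1: "C1 > 0" using P \<mu> by (simp add: C1_def)
  define J where "J t = circle_integral (\<lambda>x. \<rho> x t * \<Psi> x t * (r x t - u x t * \<theta> x t))" for t
  have J_le: "E t * \<bar>J t\<bar> \<le> mass * (E t)\<^sup>2 / 2 + C1 * Diss t" if t: "t \<ge> 0" for t
  proof -
    have "E t * \<bar>J t\<bar> = \<bar>circle_integral (\<lambda>x. E t * (\<rho> x t * \<Psi> x t * (r x t - u x t * \<theta> x t)))\<bar>"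
      unfolding circle_integral_cmult J_def using E_nonneg[OF t] by (simp add: abs_mult)
    also have "\<dots> \<le> circle_integral (\<lambda>x. P * \<mu> * (E t)\<^sup>2 * (kb * mass) * \<rho> x t + C1 * (\<rho> x t * dens x t))"
    proof (intro abs_circle_integral_le slice_intros Psi_slice dens_cont t)
      fix x
      have "\<bar>E t * (\<rho> x t * \<Psi> x t * (r x t - u x t * \<theta> x t))\<bar> =
          \<rho> x t * (\<bar>\<Psi> x t\<bar> * (E t * \<bar>r x t - u x t * \<theta> x t\<bar>))"
        using E_nonneg[OF t] rho_nonneg[OF t, of x] by (simp add: abs_mult)
      also have "\<dots> \<le> \<rho> x t * (P * (\<mu> * (E t)\<^sup>2 * (kb * mass) + dens x t / (4 * \<mu>)))"
      proof (intro mult_left_mono mult_mono rho_nonneg t P(2))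
        have "E t * \<bar>r x t - u x t * \<theta> x t\<bar> \<le> \<mu> * (E t)\<^sup>2 * \<theta> x t + dens x t / (4 * \<mu>)"
          by (rule force_le[OF t E_nonneg[OF t] \<mu>])
        also have "\<mu> * (E t)\<^sup>2 * \<theta> x t \<le> \<mu> * (E t)\<^sup>2 * (kb * mass)"
          using \<mu> theta_le[OF t] by (intro mult_left_mono) auto
        finally show "E t * \<bar>r x t - u x t * \<theta> x t\<bar> \<le>
            \<mu> * (E t)\<^sup>2 * (kb * mass) + dens x t / (4 * \<mu>)" by simp
      qed (use P E_nonneg[OF t] in auto)
      finally show "\<bar>E t * (\<rho> x t * \<Psi> x t * (r x t - u x t * \<theta> x t))\<bar> \<le>
          P * \<mu> * (E t)\<^sup>2 * (kb * mass) * \<rho> x t + C1 * (\<rho> x t * dens x t)"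
        by (simp add: C1_def algebra_simps)
    qed
    also have "\<dots> = circle_integral (\<lambda>x. P * \<mu> * (E t)\<^sup>2 * (kb * mass) * \<rho> x t) +
        circle_integral (\<lambda>x. C1 * (\<rho> x t * dens x t))"
      by (intro circle_integral_add slice_intros dens_cont t)
    also have "\<dots> = P * \<mu> * (E t)\<^sup>2 * (kb * mass) * mass + C1 * Diss t"
      by (simp only: circle_integral_cmult mass_conserved[OF t] Diss_def)
    also have "P * \<mu> * (E t)\<^sup>2 * (kb * mass) * mass = mass * (E t)\<^sup>2 / 2"
      using P kb mass_pos by (simp add: \<mu>_def field_simps)
    finally show ?thesis .
  qed
  \<comment> \<open>The sum of all coefficients of \<open>Diss\<close> in the error terms; \<open>\<epsilon> A = 1 / 2\<close> lets the dissipation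
    absorb them, and also makes \<open>E - \<epsilon> E G\<close> comparable to \<open>E\<close>.\<close>
  define A where "A = G0 + \<kappa> * (mass * U\<^sup>2) / 2 + C1 + 1"
  have G0: "G0 \<ge> 0" using G_le[of 0] by simp
  have kU: "0 \<le> \<kappa> * (mass * U\<^sup>2) / 2" using kappa_pos mass_pos by simp
  have A: "A > 0" "G0 \<le> A" using G0 C1 kU by (auto simp: A_def)
  define \<epsilon> where "\<epsilon> = 1 / (2 * A)"
  have \<epsilon>: "\<epsilon> > 0" "\<epsilon> * A = 1 / 2" using A by (auto simp: \<epsilon>_def)
  define L where "L t = E t - \<epsilon> * (E t * G t)" for t
  define L' where "L' t = - Diss t - \<epsilon> * (- Diss t * G t +
      E t * (mass * E t - \<kappa> * (Diss t / 2) + J t))" for t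
  have G_small: "\<bar>\<epsilon> * G t\<bar> \<le> 1 / 2" if t: "t \<ge> 0" for t
  proof -
    have "\<bar>\<epsilon> * G t\<bar> \<le> \<epsilon> * A" using G_le[OF t] A \<epsilon>(1) by (simp add: abs_mult)
    with \<epsilon> show ?thesis by simp
  qed
  have L_bounds: "E t / 2 \<le> L t" "L t \<le> 2 * E t" if t: "t \<ge> 0" for t
  proof -
    have "L t = E t * (1 - \<epsilon> * G t)" by (simp add: L_def algebra_simps)
    moreover have "E t * (1 / 2) \<le> E t * (1 - \<epsilon> * G t)" "E t * (1 - \<epsilon> * G t) \<le> E t * 2"
      using G_small[OF t] E_nonneg[OF t] by (intro mult_left_mono; linarith)+
    ultimately show "E t / 2 \<le> L t" "L t \<le> 2 * E t" by simp_all
  qed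
  have L_le: "L t \<le> 1 / (\<epsilon> * mass / 8 * t)" if "t > 0" for t
  proof (rule riccati_decay[OF _ _ _ _ that])
    fix t :: real assume t: "t \<ge> 0"
    show "(L has_real_derivative L' t) (at t within {0..})"
      unfolding L_def[abs_def] L'_def J_def
      by (rule DERIV_cong[OF DERIV_diff[OF E_deriv[OF t]
              DERIV_cmult[OF DERIV_mult[OF E_deriv[OF t] G_deriv[OF t]]]]])
        (simp add: algebra_simps)
    show "0 \<le> L t" using L_bounds[OF t] E_nonneg[OF t] by linarith
    have D: "0 \<le> Diss t" by (rule Diss_nonneg[OF t])
    have "\<epsilon> * (Diss t * G t) \<le> \<epsilon> * (Diss t * G0)"
      using \<epsilon>(1) D G_le[OF t] by (intro mult_left_mono) (auto simp: abs_le_iff)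
    moreover have "\<epsilon> * (E t * (\<kappa> * (Diss t / 2))) \<le> \<epsilon> * ((mass * U\<^sup>2) * (\<kappa> * (Diss t / 2)))"
      using \<epsilon>(1) D E_le[OF t] kappa_pos by (intro mult_left_mono mult_right_mono) auto
    moreover have "\<epsilon> * (E t * - J t) \<le> \<epsilon> * (mass * (E t)\<^sup>2 / 2 + C1 * Diss t)"
    proof (rule mult_left_mono)
      have "E t * - J t \<le> E t * \<bar>J t\<bar>" using E_nonneg[OF t] by (intro mult_left_mono) auto
      with J_le[OF t] show "E t * - J t \<le> mass * (E t)\<^sup>2 / 2 + C1 * Diss t" by simp
    qed (use \<epsilon> in simp)
    moreover have "L' t = - Diss t + \<epsilon> * (Diss t * G t) - \<epsilon> * mass * (E t)\<^sup>2 +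
        \<epsilon> * (E t * (\<kappa> * (Diss t / 2))) + \<epsilon> * (E t * - J t)"
      unfolding L'_def by (simp add: algebra_simps power2_eq_square)
    moreover have "\<epsilon> * (Diss t * G0) + \<epsilon> * ((mass * U\<^sup>2) * (\<kappa> * (Diss t / 2))) +
        \<epsilon> * (mass * (E t)\<^sup>2 / 2 + C1 * Diss t) =
        (\<epsilon> * A) * Diss t - \<epsilon> * Diss t + \<epsilon> * mass * (E t)\<^sup>2 / 2"
      unfolding A_def by (simp add: algebra_simps)
    moreover have "(\<epsilon> * A) * Diss t = Diss t / 2" using \<epsilon> by simp
    moreover have "0 \<le> \<epsilon> * Diss t" using \<epsilon> D by simp
    ultimately have "L' t \<le> - (\<epsilon> * mass * (E t)\<^sup>2 / 2)"
      using D by linarith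
    also have "\<dots> \<le> - (\<epsilon> * mass / 8) * (L t)\<^sup>2"
    proof -
      have "(L t)\<^sup>2 \<le> (2 * E t)\<^sup>2"
        using L_bounds[OF t] \<open>0 \<le> L t\<close> by (intro power_mono)
      then have "(\<epsilon> * mass / 8) * (L t)\<^sup>2 \<le> (\<epsilon> * mass / 8) * (2 * E t)\<^sup>2"
        using \<epsilon> mass_pos by (intro mult_left_mono) auto
      then show ?thesis by (simp add: power_mult_distrib)
    qed
    finally show "L' t \<le> - (\<epsilon> * mass / 8) * (L t)\<^sup>2" .
  qed (use \<epsilon> mass_pos in simp)
  have "E t \<le> (16 / (\<epsilon> * mass)) / t" if t: "t > 0" for t
  proof -
    have "E t \<le> 2 * L t" using L_bounds(1)[of t] t by simp
    also have "\<dots> \<le> 2 * (1 / (\<epsilon> * mass / 8 * t))" using L_le[OF t] by simp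
    also have "\<dots> = (16 / (\<epsilon> * mass)) / t" by simp
    finally show ?thesis .
  qed
  moreover have "16 / (\<epsilon> * mass) > 0" using \<epsilon> mass_pos by simp
  ultimately show ?thesis using that by blast
qed

section \<open>Decay of the velocity\<close>

lemma r_decay: obtains C where "C > 0" "\<And>x t. t > 0 \<Longrightarrow> \<bar>r x t\<bar> \<le> C * t powr (- 1 / 2)"
proof -
  obtain kb where kb: "kb > 0" "\<And>z. \<bar>k z\<bar> \<le> kb"
    using periodic_bounded[OF k_cont k_per] by blast
  obtain C where C: "C > 0" "\<And>t. t > 0 \<Longrightarrow> E t \<le> C / t"
    using energy_decay by blast
  have "\<bar>r x t\<bar> \<le> (kb * (mass + C) / 2) * t powr (- 1 / 2)" if t: "t > 0" for x t
  proof -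
    have t0: "t \<ge> 0" using t by simp
    \<comment> \<open>The size of a typical velocity; it balances both terms in \<open>\<bar>u\<bar> \<le> a / 2 + u\<^sup>2 / (2 a)\<close>.\<close>
    define a where "a = t powr (- 1 / 2)"
    have a: "a > 0" using t by (simp add: a_def)
    have "a * a = 1 / t" using t by (simp add: a_def powr_minus_divide flip: powr_add)
    then have a2: "1 / t / a = a" using a by (metis less_irrefl nonzero_mult_div_cancel_left)
    have "\<bar>r x t\<bar> \<le> circle_integral (\<lambda>y. kb * a / 2 * \<rho> y t + kb / (2 * a) * (\<rho> y t * (u y t * u y t)))"
      unfolding r_def circle_conv_def
    proof (intro abs_circle_integral_le slice_intros t0)
      fix y
      have "0 \<le> (\<bar>u y t\<bar> - a)\<^sup>2 / (2 * a)" using a by simp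
      also have "\<dots> = a / 2 + u y t * u y t / (2 * a) - \<bar>u y t\<bar>"
        using a by (simp add: field_simps power2_diff power2_eq_square)
      finally have "\<bar>u y t\<bar> \<le> a / 2 + u y t * u y t / (2 * a)" by simp
      then have "\<bar>k (x - y)\<bar> * (\<rho> y t * \<bar>u y t\<bar>) \<le> kb * (\<rho> y t * (a / 2 + u y t * u y t / (2 * a)))"
        using kb(1) rho_nonneg[OF t0] by (intro mult_mono kb(2) mult_left_mono) auto
      then show "\<bar>k (x - y) * (\<rho> y t * u y t)\<bar> \<le>
          kb * a / 2 * \<rho> y t + kb / (2 * a) * (\<rho> y t * (u y t * u y t))"
        using rho_nonneg[OF t0, of y] by (simp add: abs_mult algebra_simps)
    qed
    also have "\<dots> = circle_integral (\<lambda>y. kb * a / 2 * \<rho> y t) +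
        circle_integral (\<lambda>y. kb / (2 * a) * (\<rho> y t * (u y t * u y t)))"
      by (intro circle_integral_add slice_intros t0)
    also have "\<dots> = kb * a / 2 * mass + kb / (2 * a) * E t"
      by (simp only: circle_integral_cmult mass_conserved[OF t0] E_def)
    also have "kb / (2 * a) * E t \<le> kb / (2 * a) * (C / t)"
      using kb a by (intro mult_left_mono C(2) t) auto
    also have "kb / (2 * a) * (C / t) = kb * C / 2 * (1 / t / a)" by simp
    finally show ?thesis unfolding a2 by (simp add: a_def algebra_simps)
  qed
  moreover have "kb * (mass + C) / 2 > 0" using kb C mass_pos by simp
  ultimately show ?thesis using that by blast
qed

text \<open>
  For \<open>s = 1\<close> and \<open>s = - 1\<close> the quantity \<open>Z = s u exp (- \<lambda> s \<Psi>)\<close> satisfies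
  \<open>(\<partial>\<^sub>t + v \<partial>\<^sub>x) Z \<le> C \<bar>r\<bar> - c Z\<^sup>2\<close> wherever it is positive, provided that \<open>\<lambda> \<kappa> \<bar>u\<bar> \<le> 1\<close>;
  the term \<open>- u \<theta>\<close>, which degenerates where \<open>\<theta> = 0\<close>, is merely discarded.  As \<open>r\<close> is
  \<open>O(t\<^sup>-\<^sup>1\<^sup>/\<^sup>2)\<close>, a large multiple of \<open>t\<^sup>-\<^sup>1\<^sup>/\<^sup>4\<close> is a barrier.
\<close>

lemma velocity_decay: obtains K where "\<And>x t. t \<ge> 1 \<Longrightarrow> \<bar>u x t\<bar> \<le> K * t powr (- 1 / 4)"
proof -
  obtain P where P: "P > 0" "\<And>x t. t \<ge> 0 \<Longrightarrow> \<bar>\<Psi> x t\<bar> \<le> P"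
    using Psi_bounded by blast
  obtain U where U: "U > 0" "\<And>x t. t \<ge> 0 \<Longrightarrow> \<bar>u x t\<bar> \<le> U"
    using u_bounded by blast
  obtain C where C: "C > 0" "\<And>x t. t > 0 \<Longrightarrow> \<bar>r x t\<bar> \<le> C * t powr (- 1 / 2)"
    using r_decay by blast
  define l where "l = 1 / (\<kappa> * U)"
  have l: "l > 0" "l * \<kappa> * U = 1" using kappa_pos U by (auto simp: l_def)
  define e where "e = exp (l * P)"
  have e: "e \<ge> 1" using l P by (simp add: e_def)
  define c where "c = l * mass / e"
  have c: "c > 0" using l mass_pos e by (simp add: c_def)
  \<comment> \<open>Large enough to dominate the initial data at time \<open>1\<close>, and for the barrier \<open>K t\<^sup>-\<^sup>1\<^sup>/\<^sup>4\<close> to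
    decrease more slowly than \<open>Z\<close> at a contact point.\<close>
  define K where "K = (e * C + 1) / c + 1 / c + e * U + 1"
  have K: "K \<ge> 1" "K > e * U" "c * K\<^sup>2 > e * C + K / 4"
  proof -
    have e0: "e * C > 0" "e * U > 0" "1 / c > 0" using e C U c by simp_all
    then have q: "(e * C + 1) / c > 0" using c by simp
    show K1: "K \<ge> 1" "K > e * U" using e0 q unfolding K_def by linarith+
    have "c * K \<ge> c * ((e * C + 1) / c + 1 / c)"
      using c e0 by (intro mult_left_mono) (auto simp: K_def)
    also have "c * ((e * C + 1) / c + 1 / c) = e * C + 2" using c by (simp add: field_simps)
    finally have "c * K\<^sup>2 \<ge> (e * C + 2) * K"
      using K1 by (simp add: power2_eq_square mult_right_mono flip: mult.assoc)
    moreover have "e * C * K \<ge> e * C * 1" using K1 e0 by (intro mult_left_mono) auto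
    ultimately show "c * K\<^sup>2 > e * C + K / 4" using K1 by (simp add: algebra_simps)
  qed
  have main: "s * u x t \<le> e * K * t powr (- 1 / 4)" if s: "s\<^sup>2 = 1" and t: "t \<ge> 1" for s x t
  proof -
    have abs_s: "\<bar>s\<bar> = 1" using s by (simp add: abs_square_eq_1)
    have p_le: "\<bar>l * (s * \<Psi> x t)\<bar> \<le> l * P" if "t \<ge> 0" for x t
      using P(2)[OF that, of x] abs_s l by (simp add: abs_mult)
    have Z: "C1_field (\<lambda>x t. s * u x t * exp (- l * (s * \<Psi> x t)))
        (\<lambda>x t. s * vx x t * exp (- l * (s * \<Psi> x t)) +
           s * u x t * (exp (- l * (s * \<Psi> x t)) * (- l * (s * \<Psi>x x t))))
        (\<lambda>x t. s * vt x t * exp (- l * (s * \<Psi> x t)) +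
           s * u x t * (exp (- l * (s * \<Psi> x t)) * (- l * (s * \<Psi>t x t))))"
      by (intro C1_field_mult C1_field_exp C1_field_cmult u_field Psi_field)
    have "s * u x t * exp (- l * (s * \<Psi> x t)) < K * t powr (- 1 / 4)"
    proof (rule C1_field_below_barrier[OF Z, of 1 "\<lambda>t. K * t powr (- 1 / 4)"
          "\<lambda>t. K * ((- 1 / 4) * t powr (- 1 / 4 - 1))"])
      show "((\<lambda>t. K * t powr (- 1 / 4)) has_real_derivative
          K * ((- 1 / 4) * t powr (- 1 / 4 - 1))) (at t)" if "t \<ge> 1" for t
        using that by (intro DERIV_cmult has_real_derivative_powr) auto
      show "s * u x 1 * exp (- l * (s * \<Psi> x 1)) < K * 1 powr (- 1 / 4)" for x
      proof -
        have "s * u x 1 * exp (- l * (s * \<Psi> x 1)) \<le> \<bar>u x 1\<bar> * exp (- l * (s * \<Psi> x 1))"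
          using abs_s abs_mult[of s "u x 1"] by (intro mult_right_mono) auto
        also have "\<dots> \<le> U * e"
          using U p_le[of 1 x] by (intro mult_mono) (auto simp: e_def)
        finally show ?thesis using K by (simp add: mult.commute)
      qed
    next
      fix x t :: real
      define p where "p = l * (s * \<Psi> x t)"
      define a where "a = s * u x t"
      define q where "q = exp (- p)"
      assume t: "t > 1"
        and touch: "s * u x t * exp (- l * (s * \<Psi> x t)) = K * t powr (- 1 / 4)"
        and Zx0: "s * vx x t * exp (- l * (s * \<Psi> x t)) +
           s * u x t * (exp (- l * (s * \<Psi> x t)) * (- l * (s * \<Psi>x x t))) = 0"
      have t0: "t \<ge> 0" "t > 0" using t by auto
      have q: "q > 0" "q \<le> e" "exp p \<ge> 1 / e"
        using p_le[OF t0(1), of x]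
        by (auto simp: p_def q_def e_def simp flip: inverse_eq_divide exp_minus)
      have aq: "a * q = K * t powr (- 1 / 4)"
        using touch by (simp add: a_def q_def p_def)
      then have "a * q > 0" using K t by simp
      then have a: "a > 0" using q by (simp add: zero_less_mult_iff)
      have "a \<le> U"
        using U(2)[OF t0(1), of x] abs_s abs_mult[of s "u x t"] by (simp add: a_def)
      then have "l * \<kappa> * a \<le> l * \<kappa> * U" using l kappa_pos by (intro mult_left_mono) auto
      then have la: "0 \<le> 1 - l * \<kappa> * a" "1 - l * \<kappa> * a \<le> 1" using l kappa_pos a by auto
      have "s * vt x t * exp (- l * (s * \<Psi> x t)) +
          s * u x t * (exp (- l * (s * \<Psi> x t)) * (- l * (s * \<Psi>t x t))) =
          q * ((s * r x t - a * \<theta> x t) * (1 - l * \<kappa> * a) - l * mass * a\<^sup>2)"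
      proof -
        have x: "s * vx x t * q + a * (q * (- l * (s * \<Psi>x x t))) = 0"
          using Zx0 by (simp add: a_def q_def p_def)
        have v: "vt x t = r x t - u x t * \<theta> x t - v x t * vx x t"
          using velocity_eq[OF t0(1), of x] by simp
        have psi: "\<Psi>t x t = mass * u x t - \<kappa> * (u x t * \<theta> x t - r x t) - v x t * \<Psi>x x t"
          using Psi_material_derivative[OF t0(1), of x] by simp
        have "s * vt x t * q + a * (q * (- l * (s * \<Psi>t x t))) =
          q * ((s * r x t - a * \<theta> x t) * (1 - l * \<kappa> * a) - l * mass * a\<^sup>2)"
          using x unfolding v psi a_def by algebra
        then show ?thesis by (simp add: a_def q_def p_def)
      qed
      also have "\<dots> \<le> q * (\<bar>r x t\<bar> - l * mass * a\<^sup>2)"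
      proof -
        have "(s * r x t - a * \<theta> x t) * (1 - l * \<kappa> * a) \<le> \<bar>r x t\<bar> * (1 - l * \<kappa> * a)"
        proof (rule mult_right_mono[OF _ la(1)])
          have "s * r x t \<le> \<bar>r x t\<bar>" using abs_s abs_mult[of s "r x t"] by simp
          moreover have "0 \<le> a * \<theta> x t" using a theta_nonneg[OF t0(1)] by simp
          ultimately show "s * r x t - a * \<theta> x t \<le> \<bar>r x t\<bar>" by simp
        qed
        also have "\<dots> \<le> \<bar>r x t\<bar> * 1" using la by (intro mult_left_mono) auto
        finally show ?thesis using q by (intro mult_left_mono) auto
      qed
      also have "\<dots> = q * \<bar>r x t\<bar> - l * mass * (exp p * (a * q)\<^sup>2)"
      proof -
        have "exp p * q = 1" by (simp add: q_def flip: exp_add)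
        then show ?thesis by algebra
      qed
      also have "q * \<bar>r x t\<bar> \<le> e * (C * t powr (- 1 / 2))"
        using q C(2)[OF t0(2), of x] e by (intro mult_mono) auto
      also have "e * (C * t powr (- 1 / 2)) - l * mass * (exp p * (a * q)\<^sup>2) \<le>
          e * (C * t powr (- 1 / 2)) - c * (a * q)\<^sup>2"
      proof -
        have "l * mass * (1 / e * (a * q)\<^sup>2) \<le> l * mass * (exp p * (a * q)\<^sup>2)"
          using l mass_pos q(3) by (intro mult_left_mono mult_right_mono) auto
        then show ?thesis by (simp add: c_def)
      qed
      also have "(a * q)\<^sup>2 = K\<^sup>2 * t powr (- 1 / 2)"
        unfolding aq by (simp add: power_mult_distrib power2_eq_square[of "t powr _"] flip: powr_add)
      also have "e * (C * t powr (- 1 / 2)) - c * (K\<^sup>2 * t powr (- 1 / 2)) =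
          - (c * K\<^sup>2 - e * C) * t powr (- 1 / 2)" by (simp add: algebra_simps)
      also have "\<dots> < - (K / 4) * t powr (- 1 / 2)"
        using K(3) t by (intro mult_strict_right_mono) auto
      also have "\<dots> \<le> - (K / 4) * t powr (- 1 / 4 - 1)"
        using K t by (intro mult_left_mono_neg powr_mono) auto
      finally show "s * vt x t * exp (- l * (s * \<Psi> x t)) +
          s * u x t * (exp (- l * (s * \<Psi> x t)) * (- l * (s * \<Psi>t x t)))
          < K * ((- 1 / 4) * t powr (- 1 / 4 - 1))" by simp
    qed (use t in auto)
    then have "s * u x t * exp (- (l * (s * \<Psi> x t))) \<le> K * t powr (- 1 / 4)"
      by simp
    then have "s * u x t * exp (- (l * (s * \<Psi> x t))) * exp (l * (s * \<Psi> x t)) \<le>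
        K * t powr (- 1 / 4) * e"
    proof (rule mult_mono)
      show "exp (l * (s * \<Psi> x t)) \<le> e" using p_le[of t x] t by (simp add: e_def)
    qed (use K in auto)
    moreover have "s * u x t * exp (- (l * (s * \<Psi> x t))) * exp (l * (s * \<Psi> x t)) = s * u x t"
      by (simp add: mult.assoc flip: exp_add)
    ultimately have "s * u x t \<le> K * t powr (- 1 / 4) * e" by (simp only:)
    then show ?thesis by (simp add: mult_ac)
  qed
  have "\<bar>u x t\<bar> \<le> e * K * t powr (- 1 / 4)" if "t \<ge> 1" for x t
    using main[of 1 t x] main[of "-1" t x] that by (simp add: abs_le_iff)
  then show ?thesis using that by blast
qed

end

section \<open>From classical solutions to the named fields\<close>

lemma C1_on_continuous_on: "C1_on S f \<Longrightarrow> continuous_on S f"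
  unfolding C1_on_def by (meson has_derivative_continuous_on)

lemma C1_on_imp_C1_field:
  assumes C1: "C1_on (UNIV \<times> {0..}) (\<lambda>(x, t). g x t)"
    and per: "\<And>t. t \<ge> 0 \<Longrightarrow> circle_periodic (\<lambda>x. g x t)"
  shows "C1_field g (partial_x g) (partial_t g)"
proof -
  from C1[unfolded C1_on_def] obtain D where
    D0: "continuous_on (UNIV \<times> {0..}) D \<and> (\<forall>z\<in>UNIV \<times> {0..}.
      ((\<lambda>(x, t). g x t) has_derivative blinfun_apply (D z)) (at z within UNIV \<times> {0..}))" ..
  note D_cont = conjunct1[OF D0] and D = bspec[OF conjunct2[OF D0]]
  have lin_x: "D z (h, 0) = D z (1, 0) * h" and lin_t: "D z (0, h) = D z (0, 1) * h" for z h
    using blinfun.scaleR_right[of "D z" h "(1, 0)"] blinfun.scaleR_right[of "D z" h "(0, 1)"]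
    by (simp_all only: scaleR_Pair real_scaleR_def mult_1_left mult_zero_left mult.commute)
  have dx: "((\<lambda>y. g y t) has_real_derivative D (x, t) (1, 0)) (at x)" if t: "t \<ge> 0" for x t
  proof -
    have "((\<lambda>y. (y, t)) has_derivative (\<lambda>h. (h, 0))) (at x)"
      by (intro has_derivative_Pair has_derivative_ident has_derivative_const)
    moreover have "((\<lambda>(x, t). g x t) has_derivative blinfun_apply (D (x, t)))
        (at (x, t) within range (\<lambda>y. (y, t)))"
      by (rule has_derivative_subset[OF D]) (use t in auto)
    ultimately have "((\<lambda>y. (\<lambda>(x, t). g x t) (y, t)) has_derivative (\<lambda>h. D (x, t) (h, 0))) (at x)"
      by (rule has_derivative_in_compose)
    then show ?thesis
      unfolding has_field_derivative_def prod.case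
      by (rule has_derivative_eq_rhs) (rule ext, rule lin_x)
  qed
  have dt: "((\<lambda>s. g x s) has_real_derivative D (x, t) (0, 1)) (at t within {0..})"
    if t: "t \<ge> 0" for x t
  proof -
    have "((\<lambda>s. (x, s)) has_derivative (\<lambda>h. (0, h))) (at t within {0..})"
      by (intro has_derivative_Pair has_derivative_ident has_derivative_const)
    moreover have "((\<lambda>(x, t). g x t) has_derivative blinfun_apply (D (x, t)))
        (at (x, t) within (\<lambda>s. (x, s)) ` {0..})"
      by (rule has_derivative_subset[OF D]) (use t in auto)
    ultimately have "((\<lambda>s. (\<lambda>(x, t). g x t) (x, s)) has_derivative (\<lambda>h. D (x, t) (0, h)))
        (at t within {0..})"
      by (rule has_derivative_in_compose)
    then show ?thesis
      unfolding has_field_derivative_def prod.case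
      by (rule has_derivative_eq_rhs) (rule ext, rule lin_t)
  qed
  have px: "partial_x g x t = D (x, t) (1, 0)" if "t \<ge> 0" for x t
    unfolding partial_x_def by (rule DERIV_imp_deriv[OF dx[OF that]])
  have pt: "partial_t g x t = D (x, t) (0, 1)" if "t \<ge> 0" for x t
    unfolding partial_t_def
  proof (rule vector_derivative_within)
    show "at t within {0..} \<noteq> bot"
      using at_le[of "{t<..}" "{0..}" t] trivial_limit_at_right_real[of t] that
      by (metis atLeast_iff bot.extremum_uniqueI greaterThan_iff less_imp_le order_trans subsetI)
    show "((\<lambda>s. g x s) has_vector_derivative D (x, t) (0, 1)) (at t within {0..})"
      using dt[OF that] by (simp add: has_real_derivative_iff_has_vector_derivative)
  qed
  have D_st: "continuous_on (UNIV \<times> {0..}) (\<lambda>z. D z w)" for w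
    by (rule bounded_linear.continuous_on[OF blinfun.bounded_linear_left D_cont])
  show ?thesis
    unfolding C1_field_def
  proof (intro conjI allI impI)
    show "g (x + 2 * pi) t = g x t" if "t \<ge> 0" for x t
      using per[OF that] by (simp add: circle_periodic_def)
    show "((\<lambda>y. g y t) has_real_derivative partial_x g x t) (at x)" if "t \<ge> 0" for x t
      using dx[OF that] px[OF that] by simp
    show "((\<lambda>s. g x s) has_real_derivative partial_t g x t) (at t within {0..})"
      if "t \<ge> 0" for x t
      using dt[OF that] pt[OF that] by simp
    show "spacetime_continuous g"
      using C1_on_continuous_on[OF C1] by (simp add: spacetime_continuous_def split_beta)
    show "spacetime_continuous (partial_x g)" "spacetime_continuous (partial_t g)"
      unfolding spacetime_continuous_def
      by (rule continuous_on_eq[OF D_st[of "(1, 0)"]], force simp: px,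
        rule continuous_on_eq[OF D_st[of "(0, 1)"]], force simp: pt)
  qed
qed

lemma circle_dist_bdd_below: "bdd_below (range (\<lambda>j::int. \<bar>z + 2 * pi * of_int j\<bar>))"
  by (rule bdd_belowI[of _ 0]) auto

lemma circle_dist_eq: "circle_dist x y = circle_dist (x - y) 0"
  by (simp add: circle_dist_def)

lemma circle_dist_le: "circle_dist z 0 \<le> \<bar>z + 2 * pi * of_int j\<bar>"
  unfolding circle_dist_def using circle_dist_bdd_below[of z] by (auto intro: cINF_lower)

lemma circle_dist_ge: "(\<And>j. c \<le> \<bar>z + 2 * pi * of_int j\<bar>) \<Longrightarrow> c \<le> circle_dist z 0"
  unfolding circle_dist_def by (auto intro: cINF_greatest)

lemma circle_dist_nonneg: "0 \<le> circle_dist z 0"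
  by (rule circle_dist_ge) simp

lemma circle_dist_shift: "circle_dist (z + 2 * pi) 0 = circle_dist z 0"
proof (rule antisym)
  show "circle_dist (z + 2 * pi) 0 \<le> circle_dist z 0"
  proof (rule circle_dist_ge)
    show "circle_dist (z + 2 * pi) 0 \<le> \<bar>z + 2 * pi * of_int j\<bar>" for j
      using circle_dist_le[of "z + 2 * pi" "j - 1"] by (simp add: algebra_simps)
  qed
  show "circle_dist z 0 \<le> circle_dist (z + 2 * pi) 0"
  proof (rule circle_dist_ge)
    show "circle_dist z 0 \<le> \<bar>z + 2 * pi + 2 * pi * of_int j\<bar>" for j
      using circle_dist_le[of z "j + 1"] by (simp add: algebra_simps)
  qed
qed

lemma circle_dist_minus: "circle_dist (- z) 0 = circle_dist z 0"
proof -
  have le: "circle_dist (- z) 0 \<le> circle_dist z 0" for z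
  proof (rule circle_dist_ge)
    fix j :: int
    have "circle_dist (- z) 0 \<le> \<bar>- z + 2 * pi * of_int (- j)\<bar>" by (rule circle_dist_le)
    also have "\<dots> = \<bar>z + 2 * pi * of_int j\<bar>" by simp
    finally show "circle_dist (- z) 0 \<le> \<bar>z + 2 * pi * of_int j\<bar>" .
  qed
  from le[of z] le[of "- z"] show ?thesis by simp
qed

lemma circle_dist_cont: "continuous_on UNIV (\<lambda>z. circle_dist z 0)"
proof -
  have le: "circle_dist z 0 \<le> circle_dist w 0 + \<bar>z - w\<bar>" for z w
  proof -
    have "circle_dist z 0 - \<bar>z - w\<bar> \<le> circle_dist w 0"
    proof (rule circle_dist_ge)
      show "circle_dist z 0 - \<bar>z - w\<bar> \<le> \<bar>w + 2 * pi * of_int j\<bar>" for j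
        using circle_dist_le[of z j] by linarith
    qed
    then show ?thesis by simp
  qed
  have "dist (circle_dist z 0) (circle_dist w 0) \<le> dist z w" for z w
    using le[of z w] le[of w z] by (auto simp: dist_real_def)
  then have "1-lipschitz_on UNIV (\<lambda>z. circle_dist z 0)"
    by (intro lipschitz_onI) auto
  then show ?thesis by (rule lipschitz_on_continuous_on)
qed

lemma circle_dist_zero_eq:
  assumes "0 < z" "z < pi"
  shows "circle_dist z 0 = z"
proof (rule antisym)
  show "circle_dist z 0 \<le> z" using circle_dist_le[of z 0] assms by simp
  show "z \<le> circle_dist z 0"
  proof (rule circle_dist_ge)
    fix j :: int
    consider "j = 0" | "j \<ge> 1" | "j \<le> -1" by linarith
    then show "z \<le> \<bar>z + 2 * pi * of_int j\<bar>"
    proof cases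
      case 2
      then have "2 * pi * of_int j \<ge> 0" by simp
      then show ?thesis by linarith
    next
      case 3
      then have "2 * pi * of_int j \<le> 2 * pi * (-1)" by (intro mult_left_mono) auto
      then show ?thesis using assms by linarith
    qed simp
  qed
qed

lemma global_classical_solution_imp_circle_alignment:
  assumes C1: "C1_on {0..} \<phi>" and nonneg: "\<forall>r\<ge>0. \<phi> r \<ge> 0"
    and nontrivial: "\<exists>r\<in>{0<..<pi}. \<phi> r \<noteq> 0"
    and sol: "global_classical_solution \<phi> \<rho> v"
  shows "circle_alignment (\<lambda>z. \<phi> (circle_dist z 0)) \<rho> (partial_x \<rho>) (partial_t \<rho>)
           v (partial_x v) (partial_t v)"
proof
  note S = sol[unfolded global_classical_solution_def]
  show rho: "C1_field \<rho> (partial_x \<rho>) (partial_t \<rho>)" and v: "C1_field v (partial_x v) (partial_t v)"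
    using S by (intro C1_on_imp_C1_field; blast)+
  show cont: "continuous_on UNIV (\<lambda>z. \<phi> (circle_dist z 0))"
    by (rule continuous_on_compose2[OF C1_on_continuous_on[OF C1] circle_dist_cont])
      (auto simp: circle_dist_nonneg)
  show "\<phi> (circle_dist (z + 2 * pi) 0) = \<phi> (circle_dist z 0)" for z
    by (simp add: circle_dist_shift)
  show "\<phi> (circle_dist (- z) 0) = \<phi> (circle_dist z 0)" for z
    by (simp add: circle_dist_minus)
  show "0 \<le> \<phi> (circle_dist z 0)" for z
    using nonneg circle_dist_nonneg by simp
  obtain c where "c \<in> {0<..<pi}" "\<phi> c \<noteq> 0" using nontrivial by blast
  then show "0 < circle_integral (\<lambda>z. \<phi> (circle_dist z 0))"
    using nonneg by (intro circle_integral_pos[OF cont, of c])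
      (auto simp: circle_dist_nonneg circle_dist_zero_eq)
  show "0 \<le> \<rho> x t" if "t \<ge> 0" for x t
    using S that by blast
  show "0 < circle_integral (\<lambda>x. \<rho> x 0)"
    using S by (simp add: total_mass_def)
  show "partial_t \<rho> x t + (partial_x v x t * \<rho> x t + v x t * partial_x \<rho> x t) = 0"
    if t: "t \<ge> 0" for x t
  proof -
    have "partial_x (\<lambda>y s. v y s * \<rho> y s) x t = partial_x v x t * \<rho> x t + v x t * partial_x \<rho> x t"
      unfolding partial_x_def[of "\<lambda>y s. v y s * \<rho> y s"]
      using DERIV_mult[OF C1_fieldD(2)[OF v t] C1_fieldD(2)[OF rho t], of x]
      by (intro DERIV_imp_deriv) (simp add: mult.commute)
    moreover have "partial_t \<rho> x t + partial_x (\<lambda>y s. v y s * \<rho> y s) x t = 0"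
      using S t by blast
    ultimately show ?thesis by simp
  qed
  show "partial_t v x t + v x t * partial_x v x t =
      circle_integral (\<lambda>y. \<phi> (circle_dist (x - y) 0) * (v y t - v x t) * \<rho> y t)"
    if t: "t \<ge> 0" for x t
    using S t unfolding circle_dist_eq[of x, symmetric] by blast
qed

theorem theorem1p3:
  fixes \<phi> :: "real \<Rightarrow> real" and \<rho> v :: "real \<Rightarrow> real \<Rightarrow> real"
  assumes "C1_on {0..} \<phi>"
    and "\<forall>r\<ge>0. \<phi> r \<ge> 0"
    and "\<exists>r\<in>{0<..<pi}. \<phi> r \<noteq> 0"
    and "global_classical_solution \<phi> \<rho> v"
  shows "\<exists>vbar C. (\<forall>t\<ge>0. mean_velocity \<rho> v t = vbar) \<and>
           (\<forall>\<^sub>F t in at_top. (SUP x. \<bar>v x t - vbar\<bar>) \<le> C * (ln t / t) powr (1 / 5))"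
proof -
  interpret circle_alignment "\<lambda>z. \<phi> (circle_dist z 0)" \<rho> "partial_x \<rho>" "partial_t \<rho>"
      v "partial_x v" "partial_t v"
    by (rule global_classical_solution_imp_circle_alignment[OF assms])
  obtain K where K: "\<And>x t. t \<ge> 1 \<Longrightarrow> \<bar>u x t\<bar> \<le> K * t powr (- 1 / 4)"
    using velocity_decay by blast
  have "\<forall>\<^sub>F t in at_top. (SUP x. \<bar>v x t - vbar\<bar>) \<le> K * (ln t / t) powr (1 / 5)"
    using eventually_ge_at_top[of "exp 1"]
  proof eventually_elim
    case (elim t)
    have t1: "t \<ge> 1" using elim exp_ge_add_one_self[of 1] by linarith
    have ln: "ln t \<ge> 1" using elim t1 by (metis exp_gt_zero ln_exp ln_mono order_less_le_trans)
    have K0: "0 \<le> K" using K[of 1 0] by simp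
    have "t powr (- 1 / 4) \<le> t powr (- 1 / 5)" using t1 by (intro powr_mono) auto
    also have "\<dots> = (1 / t) powr (1 / 5)" using t1 by (simp add: powr_divide powr_minus_divide)
    also have "\<dots> \<le> (ln t / t) powr (1 / 5)"
      using t1 ln by (intro powr_mono2) (auto intro: divide_right_mono)
    finally have "K * t powr (- 1 / 4) \<le> K * (ln t / t) powr (1 / 5)"
      using K0 by (rule mult_left_mono)
    then have "\<bar>v x t - vbar\<bar> \<le> K * (ln t / t) powr (1 / 5)" for x
      using K[OF t1, of x] by (simp add: u_def)
    then show ?case by (intro cSUP_least) auto
  qed
  then show ?thesis using mean_velocity_eq by blast
qed

end
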